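(* Consider the linearly constrained problem $\min_{x\in\mathcal{X}} f(x)$ subject to $Kx=b$, and the algorithm APAPC specialized to it, as in the context, with $\lambda^+_{\min}(KK^* )>0$ (and $\mu_g=0$). Let $(x^\star,u^\star)$ satisfy $0=\nabla f(x^\star)+K^*u^\star$, $u^\star\in\mathrm{ran}(K)$, $Kx^\star=b$. Define, for $t\ge0$, $$\begin{aligned}\mathcal{E}^t_{x^\star}:={}&\frac{1}{2\gamma}\|z^{t}-x^\star\|^2+\frac{2a_{t}^2+\min\big(\frac12,\frac{1}{2a_{t}\gamma L_f}\big)\gamma\tau a_{t}^2\lambda^+_{\min}(KK^* )}{4\tau}\|v^{t}-u^\star\|^2\\&-\frac{a_{t}^2\gamma}{2}\|K^*(v^{t}-u^\star)\|^2+a_{t}^2\,\mathcal{G}_{x^\star,u^\star}(x^t,u^t)+\frac{a_t\tau}{2}\|Kx^t-b\|^2.\end{aligned}$$ Assume that $u^0=v^0\in\mathrm{ran}(K)$, $\gamma\le\frac1{2L_f}$, $\tau=\frac{\nu}{\gamma\|K\|^2}$ for some $\nu\in(0,1]$, $a_0=a_1=1$, and $$a_{t+1}:=\min\left(a_t\sqrt{1+\frac{\nu\lambda^+_{\min}(KK^* )}{4\|K\|^2}},\ \sqrt{a_t^2+a_t\frac{\nu\lambda^+_{\min}(KK^* )}{4\gamma L_f\|K\|^2}},\ \frac{1+\sqrt{1+4a_t^2}}{2}\right),\quad\forall t\ge1.$$ Then the sequence $(\mathcal{E}^t_{x^\star})_{t\ge0}$ is nonincreasing (which implies that $(z^t)_{t\ge0}$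 is bounded), $\mathcal{G}_{x^\star,u^\star}(x^t,u^t)=\mathcal{O}(1/t^2)$, $a_t=\Theta(t)$, $\|v^t-u^\star\|^2=\mathcal{O}(1/t)$, and $\|Kz^t-b\|\to0$. Consequently, there exists a solution $x^\star$ of the problem $\min f(x)$ subject to $Kx=b$ such that $(x^t)_{t\ge0}$ and $(y^t)_{t\ge0}$ both converge weakly to $x^\star$.
   Context: Setting: $\mathcal{X},\mathcal{U}$ are real Hilbert spaces; $f:\mathcal{X}\to\mathbb{R}$ is convex, differentiable and $L_f$-smooth ($\nabla f$ is $L_f$-Lipschitz), $L_f>0$; $K:\mathcal{X}\to\mathcal{U}$ is a nonzero bounded linear operator with adjoint $K^*$ and range $\mathrm{ran}(K)$; $b\in\mathrm{ran}(K)$. A primal solution is assumed to exist. $$\lambda^+_{\min}(KK^* ):=\inf_{u\in\overline{\mathrm{ran}(K)},u\ne0}\frac{\|K^*u\|^2}{\|u\|^2}.$$ (When this is positive, $\mathrm{ran}(K)$ is closed.) This is the composite problem $\min_x f(x)+h(Kx)$ with $h$ the indicator function of $\{b\}$, so $h^*(u)=\langle u,b\rangle$. Lagrangian: $\mathcal{L}(x,u):=f(x)+\langle Kx,u\rangle-\langle u,b\rangle$. Lagrangian gap: $\mathcal{G}_{x^\star,u^\star}(x,u):=\mathcal{L}(x,u^\star)-\mathcal{L}(x^\star,u)=f(x)-f(x^\star)-\langle x-x^\star,\nabla f(x^\star)\rangle$. APAPC for this problem: given $\gamma>0$, $\tau>0$, a real sequence $(a_t)_{t\ge0}$ with $a_t\ge1$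 for all $t\ge1$, $x^0=z^0\in\mathcal{X}$, $u^0=v^0\in\mathcal{U}$, iterate for $t\ge0$: $y^t:=(1-\frac1{a_{t+1}})x^t+\frac1{a_{t+1}}z^t$; $\hat z^t:=z^t-a_{t+1}\gamma\nabla f(y^t)-a_{t+1}\gamma K^*v^t$; $v^{t+1}:=v^t+\frac{\tau}{a_{t+1}}(K\hat z^t-b)$; $z^{t+1}:=z^t-a_{t+1}\gamma\nabla f(y^t)-a_{t+1}\gamma K^*v^{t+1}$; $x^{t+1}:=(1-\frac1{a_{t+1}})x^t+\frac1{a_{t+1}}z^{t+1}$; $u^{t+1}:=(1-\frac1{a_{t+1}})u^t+\frac1{a_{t+1}}v^{t+1}$. *)

theory Defs
  imports "HOL-Analysis.Analysis" "HOL-Library.Landau_Symbols"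
begin

text \<open>Throughout, a real Hilbert space is a type of sort \<open>{real_inner, complete_space}\<close>.
  The library's \<^const>\<open>adjoint\<close> is a Hilbert choice; it is the usual adjoint for bounded linear maps
  whose domain is a Hilbert space. \<^const>\<open>onorm\<close> is the operator norm.\<close>

text \<open>The infimum is meaningful in \<^typ>\<open>real\<close> only if the set is nonempty, i.e. if \<open>K\<close> is nonzero.\<close>

definition lambda_min_pos :: "('x::{real_inner,complete_space} \<Rightarrow> 'u::{real_inner,complete_space}) \<Rightarrow> real"
  where "lambda_min_pos K =
    (INF u \<in> closure (range K) - {0}. (norm (adjoint K u))\<^sup>2 / (norm u)\<^sup>2)"

definition lagrangian :: "('x::{real_inner,complete_space} \<Rightarrow> real) \<Rightarrow>
    ('x \<Rightarrow> 'u::{real_inner,complete_space}) \<Rightarrow> 'u \<Rightarrow> 'x \<Rightarrow> 'u \<Rightarrow> real"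
  where "lagrangian f K b x u = f x + K x \<bullet> u - u \<bullet> b"

definition lagrangian_gap :: "('x::{real_inner,complete_space} \<Rightarrow> real) \<Rightarrow>
    ('x \<Rightarrow> 'u::{real_inner,complete_space}) \<Rightarrow> 'u \<Rightarrow> 'x \<Rightarrow> 'u \<Rightarrow> 'x \<Rightarrow> 'u \<Rightarrow> real"
  where "lagrangian_gap f K b xs us x u = lagrangian f K b x us - lagrangian f K b xs u"

text \<open>\<open>zh\<close> is the predictor sequence, usually written z hat, and \<open>gradf\<close> is the gradient of the
  objective.\<close>

definition apapc :: "('x::{real_inner,complete_space} \<Rightarrow> 'x) \<Rightarrow>
    ('x \<Rightarrow> 'u::{real_inner,complete_space}) \<Rightarrow> 'u \<Rightarrow> real \<Rightarrow> real \<Rightarrow> (nat \<Rightarrow> real) \<Rightarrow>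
    (nat \<Rightarrow> 'x) \<Rightarrow> (nat \<Rightarrow> 'x) \<Rightarrow> (nat \<Rightarrow> 'x) \<Rightarrow> (nat \<Rightarrow> 'x) \<Rightarrow> (nat \<Rightarrow> 'u) \<Rightarrow> (nat \<Rightarrow> 'u) \<Rightarrow> bool"
  where "apapc gradf K b \<gamma> \<tau> a x y zh z u v \<longleftrightarrow>
    \<gamma> > 0 \<and> \<tau> > 0 \<and> (\<forall>t\<ge>1. a t \<ge> 1) \<and> x 0 = z 0 \<and> u 0 = v 0 \<and>
    (\<forall>t.
      y t = (1 - 1 / a (Suc t)) *\<^sub>R x t + (1 / a (Suc t)) *\<^sub>R z t \<and>
      zh t = z t - (a (Suc t) * \<gamma>) *\<^sub>R gradf (y t) - (a (Suc t) * \<gamma>) *\<^sub>R adjoint K (v t) \<and>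
      v (Suc t) = v t + (\<tau> / a (Suc t)) *\<^sub>R (K (zh t) - b) \<and>
      z (Suc t) = z t - (a (Suc t) * \<gamma>) *\<^sub>R gradf (y t) - (a (Suc t) * \<gamma>) *\<^sub>R adjoint K (v (Suc t)) \<and>
      x (Suc t) = (1 - 1 / a (Suc t)) *\<^sub>R x t + (1 / a (Suc t)) *\<^sub>R z (Suc t) \<and>
      u (Suc t) = (1 - 1 / a (Suc t)) *\<^sub>R u t + (1 / a (Suc t)) *\<^sub>R v (Suc t))"

definition energy :: "('x::{real_inner,complete_space} \<Rightarrow> real) \<Rightarrow>
    ('x \<Rightarrow> 'u::{real_inner,complete_space}) \<Rightarrow> 'u \<Rightarrow> real \<Rightarrow> real \<Rightarrow> real \<Rightarrow> (nat \<Rightarrow> real) \<Rightarrow>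
    (nat \<Rightarrow> 'x) \<Rightarrow> (nat \<Rightarrow> 'x) \<Rightarrow> (nat \<Rightarrow> 'u) \<Rightarrow> (nat \<Rightarrow> 'u) \<Rightarrow> 'x \<Rightarrow> 'u \<Rightarrow> nat \<Rightarrow> real"
  where "energy f K b Lf \<gamma> \<tau> a x z u v xs us t =
      1 / (2 * \<gamma>) * (norm (z t - xs))\<^sup>2
    + (2 * (a t)\<^sup>2 + min (1 / 2) (1 / (2 * a t * \<gamma> * Lf)) * \<gamma> * \<tau> * (a t)\<^sup>2 * lambda_min_pos K)
        / (4 * \<tau>) * (norm (v t - us))\<^sup>2
    - (a t)\<^sup>2 * \<gamma> / 2 * (norm (adjoint K (v t - us)))\<^sup>2
    + (a t)\<^sup>2 * lagrangian_gap f K b xs us (x t) (u t)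
    + a t * \<tau> / 2 * (norm (K (x t) - b))\<^sup>2"

definition weakly_converges :: "(nat \<Rightarrow> 'x::real_normed_vector) \<Rightarrow> 'x \<Rightarrow> bool"
  where "weakly_converges s l \<longleftrightarrow>
    (\<forall>\<phi> :: 'x \<Rightarrow> real. bounded_linear \<phi> \<longrightarrow> (\<lambda>n. \<phi> (s n)) \<longlonglongrightarrow> \<phi> l)"

end

theory Submission
  imports Defs
begin

text \<open>
  Expand the squared distance of \<open>z (Suc t)\<close> to a solution and combine it with the descent
  inequality for the accelerated gradient step. The only positive leftover is the feasibility term,
  which is absorbed by the preconditioned norm of the dual increment. Half of the negative terms of the gradient step
  is kept: it dominates the squared norm of \<open>adjoint K (v - us)\<close>, hence by the eigenvalue bound that
  of \<open>v - us\<close>, and this is exactly what allows \<open>a\<close> to grow linearly.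

  For the weak convergence, two solutions share the gradient and the multiplier, so the energies
  relative to them differ by an affine function of \<open>z t\<close>. Hence \<open>z t \<bullet> (l - l')\<close> converges for all
  solutions \<open>l\<close> and \<open>l'\<close>, and so does \<open>x t \<bullet> (l - l')\<close>, because \<open>x\<close> is a running average of \<open>z\<close> with
  weights of divergent sum. As every weak cluster point of \<open>x\<close> is a solution, there is only one.
\<close>

section \<open>Hilbert spaces\<close>

text \<open>For \<open>t\<close> near 0 the linear term would dominate and change sign. This is the
  first-order condition used for minimisers along lines.\<close>

lemma linear_term_zero:
  fixes \<alpha> \<beta> :: real
  assumes "\<And>t. 0 \<le> t * \<alpha> + t\<^sup>2 * \<beta>"
  shows "\<alpha> = 0"
proof (rule ccontr)
  assume "\<alpha> \<noteq> 0"
  define c where "c = \<bar>\<beta>\<bar> + 1"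
  have c: "c > 0" "\<beta> < c" by (auto simp: c_def)
  have "0 \<le> (- \<alpha> / c) * \<alpha> + (- \<alpha> / c)\<^sup>2 * \<beta>" by (rule assms)
  also have "\<dots> = \<alpha>\<^sup>2 / c\<^sup>2 * (\<beta> - c)"
    using c by (simp add: field_simps power2_eq_square)
  also have "\<dots> < 0"
    using c \<open>\<alpha> \<noteq> 0\<close> by (intro mult_pos_neg) auto
  finally show False by simp
qed

text \<open>Minimise the quadratic energy \<open>J\<close> over \<open>S\<close>: coercivity makes a
  minimising sequence Cauchy, and the first variation at its limit is the equation. \<open>A\<close>
  the identity gives Riesz; \<open>A = adjoint K\<close> solves the normal equations.\<close>

lemma coercive_representation:
  fixes A :: "'h::{real_inner,complete_space} \<Rightarrow> 'k::real_inner"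
  assumes A: "bounded_linear A" and \<phi>: "bounded_linear \<phi>"
    and S: "subspace S" "closed S"
    and c: "c > 0" "\<And>w. w \<in> S \<Longrightarrow> c * norm w \<le> norm (A w)"
  shows "\<exists>w\<in>S. \<forall>s\<in>S. A w \<bullet> A s = \<phi> s"
proof -
  interpret A: bounded_linear A by fact
  interpret \<phi>: bounded_linear \<phi> by fact
  define J where "J w = (norm (A w))\<^sup>2 - 2 * \<phi> w" for w
  define M where "M = onorm \<phi>"
  have J_lower: "- (M / c)\<^sup>2 \<le> J w" if "w \<in> S" for w
  proof -
    have "\<phi> w \<le> M * norm w"
      using onorm[OF \<phi>, of w] by (simp add: M_def)
    moreover have "(c * norm w)\<^sup>2 \<le> (norm (A w))\<^sup>2"
      using c that by (intro power_mono) auto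
    moreover have "- (M / c)\<^sup>2 \<le> (c * norm w)\<^sup>2 - 2 * (M * norm w)"
      using zero_le_power2[of "c * norm w - M / c"] c(1)
      by (simp add: power2_diff power_mult_distrib power_divide mult_ac)
    ultimately show ?thesis unfolding J_def by linarith
  qed
  define m where "m = Inf (J ` S)"
  have S0: "S \<noteq> {}" using subspace_0[OF S(1)] by auto
  have bdd: "bdd_below (J ` S)"
    using J_lower by (intro bdd_belowI2) auto
  have m_le: "m \<le> J w" if "w \<in> S" for w
    unfolding m_def using bdd that by (intro cINF_lower) auto
  have "\<exists>w\<in>S. J w < m + inverse (real (Suc n))" for n
  proof -
    have "Inf (J ` S) < m + inverse (real (Suc n))"
      unfolding m_def by simp
    then show ?thesis
      using cInf_lessD[of "J ` S"] S0 by auto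
  qed
  then obtain W where W: "\<And>n. W n \<in> S" "\<And>n. J (W n) < m + inverse (real (Suc n))"
    by metis
  \<comment> \<open>Parallelogram law: the midpoint lies in \<open>S\<close>, so \<open>J\<close> is
    at least \<open>m\<close> there, which forces near-minimisers together.\<close>
  have close: "(c * norm (p - q))\<^sup>2 \<le> 2 * (J p - m) + 2 * (J q - m)" if "p \<in> S" "q \<in> S" for p q
  proof -
    have mid: "(1/2) *\<^sub>R (p + q) \<in> S" "p - q \<in> S"
      using that S(1) by (auto simp: subspace_add subspace_scale subspace_diff)
    have "J ((1/2) *\<^sub>R (p + q)) = J p / 2 + J q / 2 - (norm (A (p - q)))\<^sup>2 / 4"
      unfolding J_def by (simp add: A.scaleR \<phi>.scaleR A.add \<phi>.add A.diff power2_norm_eq_inner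
          inner_add inner_diff inner_commute field_simps)
    with m_le[OF mid(1)] have "(norm (A (p - q)))\<^sup>2 \<le> 2 * (J p - m) + 2 * (J q - m)"
      by (simp add: algebra_simps)
    moreover have "(c * norm (p - q))\<^sup>2 \<le> (norm (A (p - q)))\<^sup>2"
      using c mid by (intro power_mono) auto
    ultimately show ?thesis by linarith
  qed
  have "Cauchy W"
  proof (rule CauchyI)
    fix e :: real assume e: "e > 0"
    \<comment> \<open>Chosen so that two excesses below \<open>\<delta>\<close> give at most
      \<open>4 * \<delta>\<close> in \<open>close\<close>, the square of
      \<open>c * e\<close>.\<close>
    define \<delta> where "\<delta> = (c * e)\<^sup>2 / 4"
    have "0 < \<delta>" using c e by (simp add: \<delta>_def)
    then obtain N where N: "inverse (real (Suc N)) < \<delta>"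
      using reals_Archimedean by blast
    have "norm (W i - W j) < e" if "i \<ge> N" "j \<ge> N" for i j
    proof -
      have "inverse (real (Suc k)) \<le> inverse (real (Suc N))" if "k \<ge> N" for k
        using that by (simp add: field_simps)
      from this[OF that(1)] this[OF that(2)] W(2)[of i] W(2)[of j] N
      have "J (W i) - m < \<delta>" "J (W j) - m < \<delta>" by linarith+
      then have "2 * (J (W i) - m) + 2 * (J (W j) - m) < 4 * \<delta>" by simp
      with close[OF W(1) W(1), of i j] have "(c * norm (W i - W j))\<^sup>2 < 4 * \<delta>"
        by (rule le_less_trans)
      also have "4 * \<delta> = (c * e)\<^sup>2" unfolding \<delta>_def by simp
      finally have "(c * norm (W i - W j))\<^sup>2 < (c * e)\<^sup>2" .
      then have "c * norm (W i - W j) < c * e"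
        by (rule power2_less_imp_less) (use c(1) e in simp)
      then show ?thesis using c(1) by (rule mult_less_cancel_left_pos[THEN iffD1, rotated])
    qed
    then show "\<exists>N. \<forall>m\<ge>N. \<forall>n\<ge>N. norm (W m - W n) < e" by blast
  qed
  then obtain w where w: "W \<longlonglongrightarrow> w"
    using Cauchy_convergent convergent_def by blast
  have wS: "w \<in> S" using closed_sequentially[OF S(2) _ w] W(1) by auto
  have "(\<lambda>n. J (W n)) \<longlonglongrightarrow> J w"
    unfolding J_def by (intro tendsto_intros A.tendsto \<phi>.tendsto w)
  moreover have "(\<lambda>n. m + inverse (real (Suc n))) \<longlonglongrightarrow> m + 0"
    by (intro tendsto_intros LIMSEQ_inverse_real_of_nat)
  ultimately have Jw: "J w \<le> m"
    using LIMSEQ_le[of "\<lambda>n. J (W n)" "J w" "\<lambda>n. m + inverse (real (Suc n))" "m + 0"] W(2)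
    by (auto intro: less_imp_le)
  show ?thesis
  proof (intro bexI ballI)
    fix s assume s: "s \<in> S"
    have "0 \<le> t * (2 * (A w \<bullet> A s - \<phi> s)) + t\<^sup>2 * (norm (A s))\<^sup>2" for t
    proof -
      have "w + t *\<^sub>R s \<in> S" using wS s S(1) by (simp add: subspace_add subspace_scale)
      from m_le[OF this] Jw have "0 \<le> J (w + t *\<^sub>R s) - J w" by linarith
      also have "\<dots> = t * (2 * (A w \<bullet> A s - \<phi> s)) + t\<^sup>2 * (norm (A s))\<^sup>2"
        unfolding J_def power2_norm_eq_inner
        by (simp add: A.scaleR \<phi>.scaleR A.add \<phi>.add
            inner_add inner_commute algebra_simps power2_eq_square)
      finally show ?thesis .
    qed
    from linear_term_zero[OF this] show "A w \<bullet> A s = \<phi> s" by simp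
  qed (rule wS)
qed

lemma riesz_representation:
  fixes \<phi> :: "'h::{real_inner,complete_space} \<Rightarrow> real"
  assumes "bounded_linear \<phi>"
  shows "\<exists>r. \<forall>s. \<phi> s = s \<bullet> r"
  using coercive_representation[OF bounded_linear_ident assms subspace_UNIV closed_UNIV, of 1]
  by (auto simp: inner_commute) metis

text \<open>\<open>adjoint\<close> is a choice, so a witness must be produced first: Riesz applied
  to the functional \<open>p \<mapsto> K p \<bullet> w\<close> for each \<open>w\<close>.\<close>

lemma adjoint_inner:
  fixes K :: "'x::{real_inner,complete_space} \<Rightarrow> 'u::real_inner"
  assumes "bounded_linear K"
  shows "K p \<bullet> w = p \<bullet> adjoint K w"
proof -
  have "\<exists>r. \<forall>s. K s \<bullet> w = s \<bullet> r" for w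
    using assms by (intro riesz_representation bounded_linear_inner_left_comp)
  then have "\<exists>K'. \<forall>p w. K p \<bullet> w = p \<bullet> K' w" by metis
  from someI_ex[OF this] show ?thesis unfolding adjoint_def by blast
qed

lemma bounded_linear_adjoint:
  fixes K :: "'x::{real_inner,complete_space} \<Rightarrow> 'u::real_inner"
  assumes K: "bounded_linear K"
  shows "bounded_linear (adjoint K)"
proof (rule bounded_linear_intro[where K = "onorm K"])
  show "adjoint K (p + q) = adjoint K p + adjoint K q" for p q
    by (rule vector_eq_ldot[THEN iffD1])
      (simp add: inner_add_right adjoint_inner[OF K, symmetric])
  show "adjoint K (r *\<^sub>R p) = r *\<^sub>R adjoint K p" for r p
    by (rule vector_eq_ldot[THEN iffD1])
      (simp add: adjoint_inner[OF K, symmetric])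
  show "norm (adjoint K w) \<le> norm w * onorm K" for w
  proof (cases "adjoint K w = 0")
    case False
    have "norm (adjoint K w) * norm (adjoint K w) = K (adjoint K w) \<bullet> w"
      by (simp add: adjoint_inner[OF K] norm_eq_sqrt_inner)
    also have "\<dots> \<le> norm (K (adjoint K w)) * norm w" by (rule norm_cauchy_schwarz)
    also have "\<dots> \<le> onorm K * norm (adjoint K w) * norm w"
      by (intro mult_right_mono onorm[OF K]) auto
    finally show ?thesis using False by (simp add: mult_ac)
  qed (use onorm_pos_le[OF K] in auto)
qed

text \<open>Weak compactness of balls by Tychonoff's theorem for the functionals \<open>p \<mapsto> X i \<bullet> p\<close>. Filters
  in place of subsequences make a diagonal argument and separability unnecessary.\<close>

lemma bounded_imp_weak_cluster_point:
  fixes X :: "'i \<Rightarrow> 'h::{real_inner,complete_space}"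
  assumes F: "F \<noteq> bot" and X: "\<And>i. norm (X i) \<le> M"
  shows "\<exists>G l. G \<le> F \<and> G \<noteq> bot \<and> (\<forall>p. ((\<lambda>i. X i \<bullet> p) \<longlongrightarrow> l \<bullet> p) G)"
proof -
  define \<Psi> where "\<Psi> i p = X i \<bullet> p" for i p
  \<comment> \<open>A product of compact intervals that contains every
    \<open>\<Psi> i\<close>.\<close>
  define C where "C = Pi\<^sub>E UNIV (\<lambda>p::'h. {- (M * norm p)..M * norm p})"
  have "compactin (product_topology (\<lambda>p. euclidean) UNIV) C"
    unfolding C_def by (subst compactin_PiE) auto
  then have "compact C"
    by (simp add: euclidean_product_topology)
  have bound: "\<bar>X i \<bullet> p\<bar> \<le> M * norm p" for i p
    using Cauchy_Schwarz_ineq2[of "X i" p] mult_right_mono[OF X, of "norm p" i] by simp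
  then have "\<Psi> i \<in> C" for i
    by (force simp: C_def \<Psi>_def abs_le_iff)
  then have "eventually (\<lambda>g. g \<in> C) (filtermap \<Psi> F)"
    by (simp add: eventually_filtermap)
  moreover have "filtermap \<Psi> F \<noteq> bot" using F by (simp add: filtermap_bot_iff)
  ultimately obtain \<psi> where \<psi>: "inf (nhds \<psi>) (filtermap \<Psi> F) \<noteq> bot"
    using \<open>compact C\<close> unfolding compact_filter by blast
  \<comment> \<open>Pulling the neighbourhoods of \<open>\<psi>\<close> back to the indices makes
    \<open>\<Psi>\<close> converge to \<open>\<psi>\<close> along \<open>G\<close>, while
    \<open>G\<close> stays finer than \<open>F\<close>.\<close>
  define G where "G = inf (filtercomap \<Psi> (nhds \<psi>)) F"
  have G: "G \<noteq> bot"
  proof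
    assume "G = bot"
    then have "eventually (\<lambda>_. False) G" by simp
    then obtain P Q where PQ: "eventually P (nhds \<psi>)" "eventually Q F" "\<And>i. P (\<Psi> i) \<Longrightarrow> Q i \<Longrightarrow> False"
      unfolding G_def eventually_inf eventually_filtercomap by blast
    have "eventually (\<lambda>g. \<not> P g) (filtermap \<Psi> F)"
      unfolding eventually_filtermap using PQ(2) by eventually_elim (use PQ(3) in blast)
    then have "eventually (\<lambda>_. False) (inf (nhds \<psi>) (filtermap \<Psi> F))"
      unfolding eventually_inf using PQ(1) by blast
    then show False using \<psi> by (simp add: trivial_limit_def)
  qed
  have lim: "((\<lambda>i. X i \<bullet> p) \<longlongrightarrow> \<psi> p) G" for p
  proof -
    have "((\<lambda>g. g p) \<longlongrightarrow> \<psi> p) (nhds \<psi>)"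
    proof (rule topological_tendstoI)
      fix U :: "real set" assume U: "open U" "\<psi> p \<in> U"
      then have "open ((\<lambda>g::'h \<Rightarrow> real. g p) -` U)"
        by (intro open_vimage continuous_on_product_coordinates)
      then show "eventually (\<lambda>g. g p \<in> U) (nhds \<psi>)"
        using U unfolding eventually_nhds by blast
    qed
    moreover have "filterlim \<Psi> (nhds \<psi>) G"
      unfolding G_def by (metis filterlim_filtercomap filterlim_mono inf_le1 order_refl)
    ultimately show ?thesis
      using filterlim_compose[of "\<lambda>g. g p" _ _ \<Psi>] by (simp add: \<Psi>_def)
  qed
  \<comment> \<open>Linearity and the bound \<open>M\<close> pass to pointwise limits, so Riesz
    turns \<open>\<psi>\<close> into a vector.\<close>
  have "bounded_linear \<psi>"
  proof (rule bounded_linear_intro[where K = M])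
    show "\<psi> (p + q) = \<psi> p + \<psi> q" for p q
      using tendsto_unique[OF G lim[of "p + q"]] tendsto_add[OF lim[of p] lim[of q]]
      by (simp add: inner_add_right)
    show "\<psi> (r *\<^sub>R p) = r *\<^sub>R \<psi> p" for r p
      using tendsto_unique[OF G lim[of "r *\<^sub>R p"]] tendsto_mult[OF tendsto_const lim[of p], of r]
      by simp
    show "norm (\<psi> p) \<le> norm p * M" for p
      using tendsto_le[OF G tendsto_const tendsto_norm[OF lim[of p]], of "norm p * M"] bound[of _ p]
      by (simp add: mult.commute)
  qed
  then obtain l where "\<And>p. \<psi> p = l \<bullet> p"
    using riesz_representation by (metis inner_commute)
  with lim G show ?thesis
    by (metis G_def inf_le2)
qed

section \<open>Smooth convex functions\<close>

lemma gradient_along_line: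
  fixes f :: "'x::real_inner \<Rightarrow> real"
  assumes "\<And>p. GDERIV f p :> gradf p"
  shows "((\<lambda>t. f (p + t *\<^sub>R d)) has_real_derivative d \<bullet> gradf (p + t *\<^sub>R d)) (at t)"
proof -
  have "((\<lambda>t. p + t *\<^sub>R d) has_derivative (\<lambda>h. h *\<^sub>R d)) (at t)"
    by (auto intro!: derivative_eq_intros)
  moreover have "(f has_derivative (\<lambda>h. h \<bullet> gradf (p + t *\<^sub>R d))) (at (p + t *\<^sub>R d))"
    using assms unfolding gderiv_def .
  ultimately have "((\<lambda>t. f (p + t *\<^sub>R d)) has_derivative (\<lambda>h. h *\<^sub>R d \<bullet> gradf (p + t *\<^sub>R d))) (at t)"
    by (rule has_derivative_compose)
  then show ?thesis
    by (simp add: has_field_derivative_def mult_commute_abs)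
qed

text \<open>On the line through \<open>p\<close> and \<open>q\<close> this is the tangent inequality
  for a convex function of one real variable.\<close>

lemma convex_gradient_lower_bound:
  fixes f :: "'x::real_inner \<Rightarrow> real"
  assumes convex: "convex_on UNIV f" and grad: "\<And>p. GDERIV f p :> gradf p"
  shows "f p + (q - p) \<bullet> gradf p \<le> f q"
proof -
  let ?\<phi> = "\<lambda>t. f (p + t *\<^sub>R (q - p))"
  have "convex_on UNIV ?\<phi>"
  proof (rule convex_onI)
    fix t r s :: real assume t: "0 < t" "t < 1"
    have "p + ((1 - t) *\<^sub>R r + t *\<^sub>R s) *\<^sub>R (q - p)
        = (1 - t) *\<^sub>R (p + r *\<^sub>R (q - p)) + t *\<^sub>R (p + s *\<^sub>R (q - p))"
      by (simp add: algebra_simps)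
    then show "?\<phi> ((1 - t) *\<^sub>R r + t *\<^sub>R s) \<le> (1 - t) * ?\<phi> r + t * ?\<phi> s"
      using convex_onD[OF convex, of t] t by (simp only:) simp
  qed simp
  moreover have "(?\<phi> has_real_derivative (q - p) \<bullet> gradf p) (at 0)"
    using gradient_along_line[OF grad, of p "q - p" 0] by simp
  ultimately show ?thesis
    using convex_on_imp_above_tangent[of UNIV ?\<phi> 0 1 "(q - p) \<bullet> gradf p"] by simp
qed

text \<open>Along the segment, \<open>f\<close> minus its quadratic model is \<open>g\<close> up to
  a constant, and \<open>g\<close> has nonpositive derivative by Cauchy-Schwarz and the Lipschitz
  bound.\<close>

lemma lipschitz_gradient_upper_bound:
  fixes f :: "'x::real_inner \<Rightarrow> real"
  assumes grad: "\<And>p. GDERIV f p :> gradf p" and smooth: "L-lipschitz_on UNIV gradf"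
  shows "f q \<le> f p + (q - p) \<bullet> gradf p + L / 2 * (norm (q - p))\<^sup>2"
proof -
  define d where "d = q - p"
  define g where "g t = f (p + t *\<^sub>R d) - t * (d \<bullet> gradf p) - L / 2 * t\<^sup>2 * (norm d)\<^sup>2" for t
  have "g 1 \<le> g 0"
  proof (rule DERIV_nonpos_imp_nonincreasing[where f = g])
    fix t :: real assume t: "0 \<le> t" "t \<le> 1"
    have "(g has_real_derivative d \<bullet> gradf (p + t *\<^sub>R d) - d \<bullet> gradf p - L * t * (norm d)\<^sup>2) (at t)"
      unfolding g_def
      by (rule derivative_eq_intros gradient_along_line[OF grad] refl)+ simp
    moreover have "d \<bullet> gradf (p + t *\<^sub>R d) - d \<bullet> gradf p \<le> L * t * (norm d)\<^sup>2"
    proof -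
      have "d \<bullet> (gradf (p + t *\<^sub>R d) - gradf p) \<le> norm d * norm (gradf (p + t *\<^sub>R d) - gradf p)"
        by (rule norm_cauchy_schwarz)
      also have "\<dots> \<le> norm d * (L * norm (t *\<^sub>R d))"
        using lipschitz_onD[OF smooth, of "p + t *\<^sub>R d" p]
        by (intro mult_left_mono) (auto simp: dist_norm)
      finally show ?thesis
        using t by (simp add: inner_diff_right power2_eq_square mult_ac)
    qed
    ultimately show "\<exists>y. (g has_real_derivative y) (at t) \<and> y \<le> 0"
      by force
  qed simp
  then show ?thesis by (simp add: g_def d_def)
qed

text \<open>Compare bounds on \<open>f w\<close>, where \<open>w\<close> is one gradient step from
  \<open>q\<close> for \<open>f\<close> minus its linear part at \<open>p\<close>: the tangent at
  \<open>p\<close> bounds it below, the quadratic model at \<open>q\<close> above. The square gained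
  over plain convexity serves in \<open>gradient_step\<close> and
  \<open>optimal_stationary\<close>.\<close>

lemma convex_smooth_gradient_gap:
  fixes f :: "'x::real_inner \<Rightarrow> real"
  assumes convex: "convex_on UNIV f" and grad: "\<And>p. GDERIV f p :> gradf p"
    and smooth: "L-lipschitz_on UNIV gradf" and L: "L > 0"
  shows "1 / (2 * L) * (norm (gradf q - gradf p))\<^sup>2 \<le> f q - f p - (q - p) \<bullet> gradf p"
proof -
  define d where "d = gradf q - gradf p"
  define w where "w = q - (1 / L) *\<^sub>R d"
  have "f p + (w - p) \<bullet> gradf p \<le> f q + (w - q) \<bullet> gradf q + L / 2 * (norm (w - q))\<^sup>2"
    using convex_gradient_lower_bound[OF convex grad, of p w]
      lipschitz_gradient_upper_bound[OF grad smooth, of w q] by linarith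
  moreover have "(w - q) \<bullet> gradf q = - (1 / L) * (norm d)\<^sup>2 - (1 / L) * (d \<bullet> gradf p)"
    unfolding power2_norm_eq_inner by (simp add: w_def d_def algebra_simps)
  moreover have "(w - p) \<bullet> gradf p = (q - p) \<bullet> gradf p - (1 / L) * (d \<bullet> gradf p)"
    by (simp add: w_def algebra_simps)
  moreover have "L / 2 * (norm (w - q))\<^sup>2 = 1 / (2 * L) * (norm d)\<^sup>2"
    using L by (simp add: w_def power2_eq_square field_simps)
  moreover have "1 / L * (norm d)\<^sup>2 = 2 * (1 / (2 * L) * (norm d)\<^sup>2)"
    by simp
  ultimately show ?thesis unfolding d_def[symmetric] by linarith
qed

section \<open>Lagrange multipliers\<close>

lemma subspace_closure:
  fixes S :: "'a::real_normed_vector set"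
  assumes "subspace S"
  shows "subspace (closure S)"
proof (rule subspaceI)
  show "0 \<in> closure S"
    using subspace_0[OF assms] closure_subset by blast
  show "p + q \<in> closure S" if "p \<in> closure S" "q \<in> closure S" for p q
    using that unfolding closure_sequential
    by (metis (no_types, lifting) assms subspace_add tendsto_add)
  show "c *\<^sub>R p \<in> closure S" if "p \<in> closure S" for c p
    using that unfolding closure_sequential
    by (metis (no_types, lifting) assms subspace_scale tendsto_const tendsto_scaleR)
qed

lemma lambda_min_pos_bound:
  fixes K :: "'x::{real_inner,complete_space} \<Rightarrow> 'u::{real_inner,complete_space}"
  assumes w: "w \<in> closure (range K)"
  shows "lambda_min_pos K * (norm w)\<^sup>2 \<le> (norm (adjoint K w))\<^sup>2"
proof (cases "w = 0")
  case False
  have "lambda_min_pos K \<le> (norm (adjoint K w))\<^sup>2 / (norm w)\<^sup>2"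
    unfolding lambda_min_pos_def using w False
    by (intro cINF_lower bdd_belowI2[where m = 0]) auto
  then show ?thesis using False by (simp add: field_simps)
qed simp

text \<open>Solving the normal equation with right side \<open>K g\<close> leaves a residual that
  lies in the kernel of \<open>K\<close> and is orthogonal to it, hence is zero. A second solve
  moves the solution from the closure of the range into the range.\<close>

lemma adjoint_range_preimage:
  fixes K :: "'x::{real_inner,complete_space} \<Rightarrow> 'u::{real_inner,complete_space}"
  assumes K: "bounded_linear K" and pos: "lambda_min_pos K > 0"
    and g: "\<And>d. K d = 0 \<Longrightarrow> g \<bullet> d = 0"
  shows "\<exists>w\<in>range K. adjoint K w = g"
proof -
  interpret K: bounded_linear K by fact
  note K' = bounded_linear_adjoint[OF K]
  interpret K': bounded_linear "adjoint K" by (rule K')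
  define S where "S = closure (range K)"
  have S: "subspace S" "closed S"
    unfolding S_def
    by (auto intro!: subspace_closure linear_subspace_image[OF K.linear_axioms subspace_UNIV])
  have coercive: "sqrt (lambda_min_pos K) * norm w \<le> norm (adjoint K w)" if "w \<in> S" for w
    using lambda_min_pos_bound[of _ K] that pos
    by (auto simp: S_def real_sqrt_mult intro!: power2_le_imp_le[of "sqrt _ * _"] simp: power_mult_distrib)
  have solve: "\<exists>w\<in>S. \<forall>s\<in>S. adjoint K w \<bullet> adjoint K s = r \<bullet> s" for r
    by (rule coercive_representation[OF K' bounded_linear_inner_right S _ coercive])
      (simp_all add: pos)
  obtain w where w: "w \<in> S" "\<And>s. s \<in> S \<Longrightarrow> adjoint K w \<bullet> adjoint K s = K g \<bullet> s"
    using solve[of "K g"] by blast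
  \<comment> \<open>\<open>K (adjoint K w')\<close> will equal \<open>w\<close>: their difference
    \<open>e\<close> lies in \<open>S\<close> and is orthogonal to \<open>S\<close>.\<close>
  obtain w' where w': "w' \<in> S" "\<And>s. s \<in> S \<Longrightarrow> adjoint K w' \<bullet> adjoint K s = w \<bullet> s"
    using solve[of w] by blast
  have range: "K p \<in> S" for p
    unfolding S_def using closure_subset[of "range K"] by auto
  define r where "r = g - adjoint K w"
  have "K r \<bullet> K r = K g \<bullet> K r - K (adjoint K w) \<bullet> K r"
    by (simp add: r_def K.diff inner_diff_left)
  also have "\<dots> = 0"
    by (simp add: w(2)[OF range] adjoint_inner[OF K, of "adjoint K w"])
  finally have "K r \<bullet> K r = 0" .
  then have "K r = 0" by simp
  then have "r \<bullet> r = 0"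
    using g[of r] adjoint_inner[OF K, of r w] by (simp add: r_def inner_diff_left inner_diff_right inner_commute)
  then have wg: "adjoint K w = g" by (simp add: r_def)
  define e where "e = K (adjoint K w') - w"
  have "e \<in> S"
    using S(1) range w(1) by (simp add: e_def subspace_diff)
  have "e \<bullet> e = K (adjoint K w') \<bullet> e - w \<bullet> e"
    by (metis e_def inner_diff_left)
  also have "\<dots> = 0"
    by (simp only: w'(2)[OF \<open>e \<in> S\<close>] adjoint_inner[OF K, of "adjoint K w'"] diff_self)
  finally have "e \<bullet> e = 0" .
  then have "w = K (adjoint K w')" by (simp add: e_def)
  with wg show ?thesis by blast
qed

text \<open>Moving along the kernel of \<open>K\<close> keeps feasibility. The quadratic upper bound
  and \<open>linear_term_zero\<close> make the gradient orthogonal to that kernel, so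
  \<open>adjoint_range_preimage\<close> applies.\<close>

lemma lagrange_multiplier_exists:
  fixes K :: "'x::{real_inner,complete_space} \<Rightarrow> 'u::{real_inner,complete_space}"
  assumes grad: "\<And>p. GDERIV f p :> gradf p" and smooth: "L-lipschitz_on UNIV gradf"
    and K: "bounded_linear K" and pos: "lambda_min_pos K > 0"
    and xs: "is_arg_min f (\<lambda>p. K p = b) xs"
  shows "\<exists>us\<in>range K. 0 = gradf xs + adjoint K us"
proof -
  interpret K: bounded_linear K by fact
  have "- gradf xs \<bullet> d = 0" if d: "K d = 0" for d
  proof -
    have "0 \<le> t * (d \<bullet> gradf xs) + t\<^sup>2 * (L / 2 * (norm d)\<^sup>2)" for t
    proof -
      have "K (xs + t *\<^sub>R d) = b"
        using xs d by (simp add: is_arg_min_def K.add K.scaleR)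
      then have "f xs \<le> f (xs + t *\<^sub>R d)"
        using xs by (force simp: is_arg_min_def)
      also have "\<dots> \<le> f xs + t * (d \<bullet> gradf xs) + t\<^sup>2 * (L / 2 * (norm d)\<^sup>2)"
        using lipschitz_gradient_upper_bound[OF grad smooth, of "xs + t *\<^sub>R d" xs]
        by (simp add: power_mult_distrib mult_ac)
      finally show ?thesis by simp
    qed
    from linear_term_zero[OF this] show ?thesis by (simp add: inner_commute)
  qed
  from adjoint_range_preimage[OF K pos this] obtain us where "us \<in> range K" "adjoint K us = - gradf xs"
    by blast
  then show ?thesis by (intro bexI[of _ us]) auto
qed

section \<open>Auxiliary inequalities and limits\<close>

text \<open>Transfers limits of inner products from \<open>z\<close> to \<open>x\<close>. Once
  \<open>k\<close> is within \<open>e / 2\<close> of \<open>l\<close>, each averaging step shrinks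
  the excess of the error over \<open>e / 2\<close>; the upper bound on \<open>a\<close> makes the
  product of the factors vanish.\<close>

lemma weighted_average_tendsto:
  fixes h k a :: "nat \<Rightarrow> real"
  assumes h: "\<And>t. h (Suc t) = (1 - 1 / a (Suc t)) * h t + 1 / a (Suc t) * k (Suc t)"
    and a: "\<And>t. 1 \<le> a t" "\<And>t. a t \<le> real t + 1"
    and k: "k \<longlonglongrightarrow> l"
  shows "h \<longlonglongrightarrow> l"
proof (rule LIMSEQ_I)
  fix e :: real assume e: "0 < e"
  then obtain N where N: "\<And>t. t \<ge> N \<Longrightarrow> \<bar>k t - l\<bar> < e / 2"
    using LIMSEQ_D[OF k, of "e / 2"] by auto
  define d where "d t = max 0 (\<bar>h t - l\<bar> - e / 2)" for t
  have d0: "0 \<le> d t" for t by (simp add: d_def)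
  \<comment> \<open>Since \<open>1 / a (Suc t) \<ge> 1 / (t + 2)\<close>, the excess \<open>d\<close> decays at least like \<open>1 / (t + 1)\<close>.\<close>
  have descent: "(real (Suc t) + 1) * d (Suc t) \<le> (real t + 1) * d t" if "t \<ge> N" for t
  proof -
    define s where "s = 1 / a (Suc t)"
    have s: "0 < s" "s \<le> 1" "1 / (real t + 2) \<le> s"
      using a(1)[of "Suc t"] a(2)[of "Suc t"] by (auto simp: s_def field_simps)
    have "h (Suc t) - l = (1 - s) * (h t - l) + s * (k (Suc t) - l)"
      by (simp add: h s_def[symmetric] algebra_simps)
    then have "\<bar>h (Suc t) - l\<bar> \<le> (1 - s) * \<bar>h t - l\<bar> + s * \<bar>k (Suc t) - l\<bar>"
      using s abs_triangle_ineq[of "(1 - s) * (h t - l)" "s * (k (Suc t) - l)"]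
      by (simp add: abs_mult)
    also have "\<dots> \<le> (1 - s) * (d t + e / 2) + s * (e / 2)"
      using N[of "Suc t"] that s by (intro add_mono mult_left_mono) (auto simp: d_def)
    also have "\<dots> = (1 - s) * d t + e / 2" by (simp add: field_simps)
    finally have "d (Suc t) \<le> (1 - s) * d t"
      using s d0[of t] unfolding d_def by auto
    also have "\<dots> \<le> (1 - 1 / (real t + 2)) * d t"
      using s d0[of t] by (intro mult_right_mono) auto
    finally have "(real t + 2) * d (Suc t) \<le> (real t + 2) * ((1 - 1 / (real t + 2)) * d t)"
      by (intro mult_left_mono) auto
    also have "\<dots> = (real t + 1) * d t" by (simp add: field_simps)
    finally show ?thesis by (simp add: add.commute)
  qed
  have bound: "(real t + 1) * d t \<le> (real N + 1) * d N" if "t \<ge> N" for t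
    using that
  proof (induction t rule: dec_induct)
    case (step n)
    then show ?case using descent[of n] by linarith
  qed simp
  have "(\<lambda>t. (real N + 1) * d N / (real t + 1)) \<longlonglongrightarrow> 0"
    using tendsto_mult_right_zero[OF LIMSEQ_inverse_real_of_nat, of "(real N + 1) * d N"]
    by (simp add: divide_inverse add.commute)
  then obtain M where M: "\<And>t. t \<ge> M \<Longrightarrow> \<bar>(real N + 1) * d N / (real t + 1)\<bar> < e / 2"
    using LIMSEQ_D[of _ 0 "e / 2"] e by (metis diff_zero half_gt_zero real_norm_def)
  have "\<bar>h t - l\<bar> < e" if "t \<ge> max M N" for t
  proof -
    have "d t \<le> (real N + 1) * d N / (real t + 1)"
      using bound[of t] that by (simp add: field_simps)
    moreover have "\<bar>(real N + 1) * d N / (real t + 1)\<bar> < e / 2"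
      using M that by auto
    ultimately have "d t < e / 2" by (meson abs_ge_self le_less_trans)
    moreover have "\<bar>h t - l\<bar> - e / 2 \<le> d t" by (simp add: d_def)
    ultimately show ?thesis by linarith
  qed
  then show "\<exists>M. \<forall>t\<ge>M. norm (h t - l) < e"
    unfolding real_norm_def by blast
qed

text \<open>For \<open>Q\<close>, the identity minus \<open>c\<close> times \<open>K\<close> after
  its adjoint, this says that the square of \<open>Q\<close> is at most \<open>Q\<close>: the bound
  on \<open>c\<close> places \<open>Q\<close> between 0 and the identity.\<close>

lemma preconditioner_contraction:
  fixes K :: "'x::{real_inner,complete_space} \<Rightarrow> 'u::{real_inner,complete_space}"
  assumes K: "bounded_linear K" and c: "0 \<le> c" "c * (onorm K)\<^sup>2 \<le> 1"
  shows "(norm (w - c *\<^sub>R K (adjoint K w)))\<^sup>2 \<le> (norm w)\<^sup>2 - c * (norm (adjoint K w))\<^sup>2"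
proof -
  define p where "p = adjoint K w"
  have "(norm (w - c *\<^sub>R K p))\<^sup>2 = (norm w)\<^sup>2 - 2 * c * (K p \<bullet> w) + c\<^sup>2 * (norm (K p))\<^sup>2"
    unfolding power2_norm_eq_inner
    by (simp add: inner_diff inner_commute power2_eq_square algebra_simps)
  moreover have "K p \<bullet> w = (norm p)\<^sup>2"
    by (simp add: adjoint_inner[OF K] p_def power2_norm_eq_inner)
  moreover have "c\<^sup>2 * (norm (K p))\<^sup>2 \<le> c * (norm p)\<^sup>2"
  proof -
    have "(norm (K p))\<^sup>2 \<le> (onorm K)\<^sup>2 * (norm p)\<^sup>2"
      using power_mono[OF onorm[OF K, of p], of 2] by (simp add: power_mult_distrib)
    then have "c * (norm (K p))\<^sup>2 \<le> c * (onorm K)\<^sup>2 * (norm p)\<^sup>2"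
      using c by (simp add: mult.assoc mult_left_mono)
    also have "\<dots> \<le> (norm p)\<^sup>2"
      using c(2) by (rule mult_left_le_one_le[rotated 2]) (use c in auto)
    finally show ?thesis
      using c(1) by (simp add: power2_eq_square mult.assoc mult_left_mono)
  qed
  ultimately show ?thesis by (simp add: p_def)
qed

text \<open>Rests on the squared norm of \<open>2 *\<^sub>R q + p\<close> being nonnegative. The
  caps \<open>1 / 2\<close> and \<open>r\<close> on the weight are where the minimum in the energy
  comes from.\<close>

lemma young_parallel_sum:
  fixes p q :: "'a::real_inner"
  assumes m: "0 \<le> m" "m \<le> 1 / 2" "m \<le> r"
  shows "m / 4 * (norm p)\<^sup>2 \<le> 1 / 4 * (norm (q + p))\<^sup>2 + r * (norm q)\<^sup>2"
proof -
  have "(norm p)\<^sup>2 \<le> 2 * (norm (q + p))\<^sup>2 + 2 * (norm q)\<^sup>2"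
    using inner_ge_zero[of "2 *\<^sub>R q + p"] unfolding power2_norm_eq_inner
    by (simp add: inner_add inner_commute)
  then have "m / 4 * (norm p)\<^sup>2 \<le> m / 4 * (2 * (norm (q + p))\<^sup>2 + 2 * (norm q)\<^sup>2)"
    using m(1) by (intro mult_left_mono) auto
  also have "\<dots> = m / 2 * (norm (q + p))\<^sup>2 + m / 2 * (norm q)\<^sup>2"
    by (simp add: algebra_simps)
  also have "m / 2 * (norm (q + p))\<^sup>2 \<le> 1 / 4 * (norm (q + p))\<^sup>2"
    by (rule mult_right_mono) (use m in auto)
  also have "m / 2 * (norm q)\<^sup>2 \<le> r * (norm q)\<^sup>2"
    by (rule mult_right_mono) (use m in auto)
  finally show ?thesis by simp
qed

lemma power2_norm_convex_combination:
  fixes p q :: "'a::real_inner"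
  assumes "0 \<le> r" "r \<le> 1"
  shows "(norm ((1 - r) *\<^sub>R p + r *\<^sub>R q))\<^sup>2 \<le> (1 - r) * (norm p)\<^sup>2 + r * (norm q)\<^sup>2"
proof -
  have "(1 - r) * (norm p)\<^sup>2 + r * (norm q)\<^sup>2 - (norm ((1 - r) *\<^sub>R p + r *\<^sub>R q))\<^sup>2
      = r * (1 - r) * (norm (p - q))\<^sup>2"
    unfolding power2_norm_eq_inner
    by (simp add: inner_add inner_diff inner_commute algebra_simps)
  moreover have "0 \<le> r * (1 - r) * (norm (p - q))\<^sup>2" using assms by simp
  ultimately show ?thesis by linarith
qed

lemma LIMSEQ_zero_squeeze:
  fixes g h :: "nat \<Rightarrow> real"
  assumes "\<And>n. 0 \<le> g n" "\<And>n. g n \<le> h n" "h \<longlonglongrightarrow> 0"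
  shows "g \<longlonglongrightarrow> 0"
  by (rule tendsto_sandwich[OF _ _ tendsto_const assms(3)]) (simp_all add: assms(1,2))

lemma LIMSEQ_zero_squeeze_power2:
  fixes g h :: "nat \<Rightarrow> real"
  assumes "\<And>n. 0 \<le> g n" "\<And>n. (g n)\<^sup>2 \<le> h n" "h \<longlonglongrightarrow> 0"
  shows "g \<longlonglongrightarrow> 0"
proof (rule LIMSEQ_zero_squeeze)
  show "g n \<le> sqrt (h n)" for n using assms(2) by (rule real_le_rsqrt)
  show "(\<lambda>n. sqrt (h n)) \<longlonglongrightarrow> 0" using tendsto_real_sqrt[OF assms(3)] by simp
qed (rule assms(1))

section \<open>The parameter sequence\<close>

locale apapc_run =
  fixes f :: "'x::{real_inner,complete_space} \<Rightarrow> real"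
    and gradf :: "'x \<Rightarrow> 'x"
    and K :: "'x \<Rightarrow> 'u::{real_inner,complete_space}"
    and b :: 'u
    and Lf \<gamma> \<tau> \<nu> :: real
    and a :: "nat \<Rightarrow> real"
    and x y zh z :: "nat \<Rightarrow> 'x"
    and u v :: "nat \<Rightarrow> 'u"
  assumes convex: "convex_on UNIV f"
    and gradient: "\<And>p. GDERIV f p :> gradf p"
    and Lf_pos: "Lf > 0"
    and smooth: "Lf-lipschitz_on UNIV gradf"
    and K_bounded_linear: "bounded_linear K"
    and K_nonzero: "K \<noteq> (\<lambda>_. 0)"
    and b_range: "b \<in> range K"
    and lambda_pos: "lambda_min_pos K > 0"
    and algorithm: "apapc gradf K b \<gamma> \<tau> a x y zh z u v"
    and v0_range: "v 0 \<in> range K"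
    and gamma_le: "\<gamma> \<le> 1 / (2 * Lf)"
    and nu: "0 < \<nu>" "\<nu> \<le> 1"
    and tau: "\<tau> = \<nu> / (\<gamma> * (onorm K)\<^sup>2)"
    and a_init: "a 0 = 1" "a 1 = 1"
    and a_rec: "\<And>t. t \<ge> 1 \<Longrightarrow> a (Suc t) =
      min (min (a t * sqrt (1 + \<nu> * lambda_min_pos K / (4 * (onorm K)\<^sup>2)))
               (sqrt ((a t)\<^sup>2 + a t * (\<nu> * lambda_min_pos K / (4 * \<gamma> * Lf * (onorm K)\<^sup>2)))))
          ((1 + sqrt (1 + 4 * (a t)\<^sup>2)) / 2)"
begin

sublocale K: bounded_linear K by (rule K_bounded_linear)

sublocale adjK: bounded_linear "adjoint K" by (rule bounded_linear_adjoint[OF K_bounded_linear])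

abbreviation \<Lambda> :: real where "\<Lambda> \<equiv> lambda_min_pos K"

text \<open>The minimum that weights the dual distance in \<open>energy\<close>.\<close>

definition m :: "nat \<Rightarrow> real" where
  "m t = min (1 / 2) (1 / (2 * a t * \<gamma> * Lf))"

lemma gamma_pos: "\<gamma> > 0" and tau_pos: "\<tau> > 0"
  and y_eq: "y t = (1 - 1 / a (Suc t)) *\<^sub>R x t + (1 / a (Suc t)) *\<^sub>R z t"
  and zh_eq: "zh t = z t - (a (Suc t) * \<gamma>) *\<^sub>R gradf (y t) - (a (Suc t) * \<gamma>) *\<^sub>R adjoint K (v t)"
  and v_eq: "v (Suc t) = v t + (\<tau> / a (Suc t)) *\<^sub>R (K (zh t) - b)"
  and z_eq: "z (Suc t) = z t - (a (Suc t) * \<gamma>) *\<^sub>R gradf (y t) - (a (Suc t) * \<gamma>) *\<^sub>R adjoint K (v (Suc t))"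
  and x_eq: "x (Suc t) = (1 - 1 / a (Suc t)) *\<^sub>R x t + (1 / a (Suc t)) *\<^sub>R z (Suc t)"
  and x0: "x 0 = z 0"
  using algorithm unfolding apapc_def by blast+

lemma a_0_1 [simp]: "a 0 = 1" "a (Suc 0) = 1"
  using a_init by simp_all

lemma a_ge_1: "a t \<ge> 1"
  using algorithm a_init by (cases "t = 0") (auto simp: apapc_def)

lemma onorm_pos: "onorm K > 0"
proof -
  from K_nonzero obtain p where "K p \<noteq> 0" by auto
  then show ?thesis using onorm_pos_lt[OF K_bounded_linear] by blast
qed

lemma gamma_tau: "\<gamma> * \<tau> * (onorm K)\<^sup>2 = \<nu>"
  using onorm_pos gamma_pos by (simp add: tau)

lemma gamma_Lf: "\<gamma> * Lf \<le> 1 / 2"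
  using gamma_le Lf_pos by (simp add: field_simps)

lemma growth_const_pos:
  "0 < \<nu> * \<Lambda> / (4 * (onorm K)\<^sup>2)" "0 < \<nu> * \<Lambda> / (4 * \<gamma> * Lf * (onorm K)\<^sup>2)"
  using nu lambda_pos onorm_pos gamma_pos Lf_pos by simp_all

text \<open>\<open>r\<close> is the parameter update of Nesterov acceleration, the positive root of
  the quadratic equation in the first claim.\<close>

lemma a_root_bounds:
  fixes s :: real
  assumes "1 \<le> s"
  defines "r \<equiv> (1 + sqrt (1 + 4 * s\<^sup>2)) / 2"
  shows "r\<^sup>2 - r = s\<^sup>2" "r \<le> s + 1" "s + 1 / 2 \<le> r"
proof -
  have "(sqrt (1 + 4 * s\<^sup>2))\<^sup>2 = 1 + 4 * s\<^sup>2" by simp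
  then show "r\<^sup>2 - r = s\<^sup>2"
    unfolding r_def by (simp add: power2_eq_square field_simps)
  have "sqrt (1 + 4 * s\<^sup>2) \<le> 2 * s + 1"
    using assms by (intro real_le_lsqrt) (auto simp: power2_sum power_mult_distrib)
  then show "r \<le> s + 1" by (simp add: r_def)
  have "2 * s \<le> sqrt (1 + 4 * s\<^sup>2)"
    by (intro real_le_rsqrt) (simp add: power_mult_distrib)
  then show "s + 1 / 2 \<le> r" by (simp add: r_def)
qed

lemma a_Suc_le_root: "a (Suc t) \<le> (1 + sqrt (1 + 4 * (a t)\<^sup>2)) / 2"
proof (cases "t = 0")
  \<comment> \<open>The recursion starts at index 1, so index 0 rests on the initial values.\<close>
  case True
  then show ?thesis
    using a_root_bounds(3)[of 1] a_init by simp
next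
  case False
  then have "t \<ge> 1" by simp
  show ?thesis unfolding a_rec[OF \<open>t \<ge> 1\<close>] by (rule min.cobounded2)
qed

text \<open>\<open>r * (r - 1)\<close> increases for \<open>r \<ge> 1\<close>, so the bound by the
  root suffices. It lets the gap weights telescope.\<close>

lemma a_Suc_sq: "(a (Suc t))\<^sup>2 - a (Suc t) \<le> (a t)\<^sup>2"
proof -
  define r where "r = (1 + sqrt (1 + 4 * (a t)\<^sup>2)) / 2"
  have "a (Suc t) * (a (Suc t) - 1) \<le> r * (r - 1)"
    using a_Suc_le_root[of t] a_ge_1[of "Suc t"] unfolding r_def[symmetric]
    by (intro mult_mono) auto
  then show ?thesis
    using a_root_bounds(1)[OF a_ge_1[of t]] unfolding r_def[symmetric]
    by (simp add: algebra_simps power2_eq_square)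
qed

lemma a_le: "a t \<le> real t + 1"
proof (induction t)
  case (Suc t)
  then show ?case
    using a_Suc_le_root[of t] a_root_bounds(2)[OF a_ge_1[of t]] by simp
qed simp

lemma a_increment: "\<exists>c>0. \<forall>t\<ge>1. a t + c \<le> a (Suc t)"
proof -
  define q where "q = sqrt (1 + \<nu> * \<Lambda> / (4 * (onorm K)\<^sup>2)) - 1"
  define \<beta> where "\<beta> = \<nu> * \<Lambda> / (4 * \<gamma> * Lf * (onorm K)\<^sup>2)"
  have q: "q > 0" using growth_const_pos(1) by (simp add: q_def)
  have \<beta>: "\<beta> > 0" using growth_const_pos(2) by (simp add: \<beta>_def)
  \<comment> \<open>\<open>q\<close> serves the first entry of the minimum because
    \<open>a t \<ge> 1\<close>, and \<open>1 / 2\<close> the third. For the second,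
    \<open>c \<le> a t\<close> bounds the square of \<open>a t + c\<close> by that of
    \<open>a t\<close> plus \<open>3 * c * a t\<close>, whence \<open>\<beta> / 3\<close>.\<close>
  define c where "c = min q (min (\<beta> / 3) (1 / 2))"
  have c: "c > 0" "c \<le> q" "c \<le> \<beta> / 3" "c \<le> 1 / 2"
    using q \<beta> by (auto simp: c_def)
  have "a t + c \<le> a (Suc t)" if "t \<ge> 1" for t
  proof -
    note at = a_ge_1[of t]
    have "c \<le> a t * q"
      using mult_mono[of 1 "a t" c q] at c by simp
    then have "a t + c \<le> a t * sqrt (1 + \<nu> * \<Lambda> / (4 * (onorm K)\<^sup>2))"
      by (simp add: q_def algebra_simps)
    moreover have "a t + c \<le> sqrt ((a t)\<^sup>2 + a t * \<beta>)"
    proof (rule real_le_rsqrt)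
      have "c * c \<le> a t * c" using at c by (intro mult_right_mono) auto
      moreover have "a t * (3 * c) \<le> a t * \<beta>" using at c by (intro mult_left_mono) auto
      ultimately show "(a t + c)\<^sup>2 \<le> (a t)\<^sup>2 + a t * \<beta>"
        by (simp add: power2_eq_square algebra_simps)
    qed
    moreover have "a t + c \<le> (1 + sqrt (1 + 4 * (a t)\<^sup>2)) / 2"
      using a_root_bounds(3)[OF at] c by simp
    ultimately show ?thesis
      unfolding a_rec[OF that] \<beta>_def by (intro min.boundedI)
  qed
  with c show ?thesis by blast
qed

lemma a_mono: "a t \<le> a (Suc t)"
proof (cases "t = 0")
  case False
  obtain c where "c > 0" "\<forall>t\<ge>1. a t + c \<le> a (Suc t)" using a_increment by blast
  with False have "a t + c \<le> a (Suc t)" "c > 0" by auto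
  then show ?thesis by linarith
qed simp

lemma a_ge_linear: "\<exists>c>0. \<forall>t. c * (real t + 1) \<le> a t"
proof -
  obtain c where c: "c > 0" "\<And>t. t \<ge> 1 \<Longrightarrow> a t + c \<le> a (Suc t)"
    using a_increment by blast
  \<comment> \<open>The cap \<open>1 / 2\<close> starts the induction at index 1, where
    \<open>2 * k \<le> 1\<close> is required.\<close>
  define k where "k = min (1 / 2) c"
  have k: "k > 0" "k \<le> 1 / 2" "k \<le> c" using c by (auto simp: k_def)
  have "k * (real (Suc t) + 1) \<le> a (Suc t)" for t
  proof (induction t)
    case (Suc t)
    then show ?case using c(2)[of "Suc t"] k(3) by (simp add: algebra_simps)
  qed (use k a_init in simp)
  moreover have "k * (real 0 + 1) \<le> a 0" using k a_init by simp
  ultimately have "k * (real t + 1) \<le> a t" for t by (cases t) auto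
  with k show ?thesis by blast
qed

lemma a_bigtheta: "a \<in> \<Theta>(\<lambda>t. real t)"
proof
  show "a \<in> O(\<lambda>t. real t)"
  proof (rule bigoI[of _ 2])
    show "\<forall>\<^sub>F t in at_top. norm (a t) \<le> 2 * norm (real t)"
      using eventually_ge_at_top[of 1]
    proof eventually_elim
      case (elim t)
      then show ?case using a_le[of t] a_ge_1[of t] by simp
    qed
  qed
  obtain c where c: "c > 0" "\<And>t. c * (real t + 1) \<le> a t" using a_ge_linear by blast
  have "(\<lambda>t. real t) \<in> O(a)"
  proof (rule bigoI[of _ "1 / c"])
    have "real t \<le> a t / c" for t
      using c(2)[of t] c(1) by (simp add: field_simps)
    then show "\<forall>\<^sub>F t in at_top. norm (real t) \<le> 1 / c * norm (a t)"
      using a_ge_1 by (auto simp: order_trans[OF _ a_ge_1] abs_of_nonneg[OF order_trans[OF zero_le_one a_ge_1]])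
  qed
  then show "a \<in> \<Omega>(\<lambda>t. real t)" by (simp add: bigomega_iff_bigo)
qed

text \<open>The last bound combines \<open>a t \<ge> 1\<close> with
  \<open>\<gamma> * Lf \<le> 1 / 2\<close>. It makes \<open>m t * (a t)\<^sup>2\<close> at least
  \<open>a t / 2\<close>, the source of the dual rate.\<close>

lemma m_bounds: "0 < m t" "m t \<le> 1 / 2" "m t \<le> 1 / (2 * a t * \<gamma> * Lf)" "1 / (2 * a t) \<le> m t"
proof -
  have a: "0 < a t" using a_ge_1[of t] by simp
  have g: "0 < \<gamma> * Lf" using gamma_pos Lf_pos by simp
  show "0 < m t" using a gamma_pos Lf_pos by (simp add: m_def)
  show "m t \<le> 1 / 2" "m t \<le> 1 / (2 * a t * \<gamma> * Lf)" by (simp_all add: m_def)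
  have "1 / (2 * a t) \<le> 1 / 2" using a_ge_1[of t] by (simp add: field_simps)
  moreover have "1 / (2 * a t) \<le> 1 / (2 * a t * \<gamma> * Lf)"
  proof (rule divide_left_mono)
    have "2 * a t * (\<gamma> * Lf) \<le> 2 * a t * 1" using a gamma_Lf by (intro mult_left_mono) auto
    then show "2 * a t * \<gamma> * Lf \<le> 2 * a t" by (simp add: mult.assoc)
  qed (use a gamma_pos Lf_pos in auto)
  ultimately show "1 / (2 * a t) \<le> m t" by (simp add: m_def)
qed

text \<open>The first two entries of the recursion are tuned to the two branches of
  \<open>m t\<close>, and each yields this same bound. At index 0 the left side vanishes.\<close>

lemma a_Suc_sq_growth: "(a (Suc t))\<^sup>2 - (a t)\<^sup>2 \<le> \<gamma> * \<tau> * m t * \<Lambda> * (a t)\<^sup>2 / 2"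
proof (cases "t = 0")
  case True
  then show ?thesis using m_bounds(1)[of 0] gamma_pos tau_pos lambda_pos a_init by simp
next
  case False
  then have t: "t \<ge> 1" by simp
  have a: "0 < a t" "0 < a (Suc t)" using a_ge_1[of t] a_ge_1[of "Suc t"] by simp_all
  have gt: "\<gamma> * \<tau> = \<nu> / (onorm K)\<^sup>2"
    using gamma_tau onorm_pos by (simp add: field_simps)
  show ?thesis
  proof (cases "1 / 2 \<le> 1 / (2 * a t * \<gamma> * Lf)")
    case True
    then have m: "m t = 1 / 2" by (simp add: m_def)
    have "(a (Suc t))\<^sup>2 \<le> (a t * sqrt (1 + \<nu> * \<Lambda> / (4 * (onorm K)\<^sup>2)))\<^sup>2"
      using a unfolding a_rec[OF t] by (intro power_mono) (auto intro: min.coboundedI1)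
    also have "\<dots> = (a t)\<^sup>2 * (1 + \<nu> * \<Lambda> / (4 * (onorm K)\<^sup>2))"
      using growth_const_pos(1) by (simp add: power_mult_distrib)
    finally show ?thesis by (simp add: m gt algebra_simps)
  next
    case False
    then have m: "m t = 1 / (2 * a t * \<gamma> * Lf)" by (simp add: m_def)
    have pos: "0 \<le> a t * (\<nu> * \<Lambda> / (4 * \<gamma> * Lf * (onorm K)\<^sup>2))"
      using growth_const_pos(2) a by (intro mult_nonneg_nonneg less_imp_le)
    have "(a (Suc t))\<^sup>2 \<le> (sqrt ((a t)\<^sup>2 + a t * (\<nu> * \<Lambda> / (4 * \<gamma> * Lf * (onorm K)\<^sup>2))))\<^sup>2"
      using a unfolding a_rec[OF t] by (intro power_mono) (auto intro: min.coboundedI1)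
    also have "\<dots> = (a t)\<^sup>2 + a t * (\<nu> * \<Lambda> / (4 * \<gamma> * Lf * (onorm K)\<^sup>2))"
      using pos by simp
    also have "a t * (\<nu> * \<Lambda> / (4 * \<gamma> * Lf * (onorm K)\<^sup>2)) = \<gamma> * \<tau> * m t * \<Lambda> * (a t)\<^sup>2 / 2"
      using a gamma_pos Lf_pos onorm_pos unfolding gt m by (simp add: field_simps power2_eq_square)
    finally show ?thesis by simp
  qed
qed

end

section \<open>The energy\<close>

text \<open>Each dual update adds a multiple of \<open>K (zh t) - b\<close>, so the iterates stay in
  the range, where the eigenvalue bound holds.\<close>

lemma (in apapc_run) v_diff_range: "v t - us \<in> closure (range K)" if "us \<in> range K"
proof -
  have sub: "subspace (range K)"
    by (rule linear_subspace_image[OF K.linear_axioms subspace_UNIV])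
  have "v t \<in> range K"
  proof (induction t)
    case (Suc t)
    then show ?case
      unfolding v_eq using b_range
      by (intro subspace_add[OF sub] subspace_scale[OF sub] subspace_diff[OF sub]) auto
  qed (rule v0_range)
  then have "v t - us \<in> range K" using that by (rule subspace_diff[OF sub])
  then show ?thesis using closure_subset[of "range K"] by auto
qed

text \<open>Separate from \<open>apapc_run\<close> so that one run can be viewed from several
  solutions sharing a multiplier, as the weak convergence argument does.\<close>

locale apapc_saddle = apapc_run f gradf K b Lf \<gamma> \<tau> \<nu> a x y zh z u v
  for f :: "'x::{real_inner,complete_space} \<Rightarrow> real"
    and gradf :: "'x \<Rightarrow> 'x"
    and K :: "'x \<Rightarrow> 'u::{real_inner,complete_space}"
    and b :: 'u
    and Lf \<gamma> \<tau> \<nu> :: real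
    and a :: "nat \<Rightarrow> real"
    and x y zh z :: "nat \<Rightarrow> 'x"
    and u v :: "nat \<Rightarrow> 'u" +
  fixes xs :: 'x and us :: 'u
  assumes stationary: "0 = gradf xs + adjoint K us"
    and us_range: "us \<in> range K"
    and feasible: "K xs = b"
begin

text \<open>The Bregman distance of \<open>f\<close> from \<open>xs\<close>.\<close>

definition gap :: "'x \<Rightarrow> real" where
  "gap p = f p - f xs - (p - xs) \<bullet> gradf xs"

text \<open>Up to the factor \<open>s\<^sup>2 / (2 * \<tau>)\<close>, the quadratic form of the
  preconditioner: the identity minus \<open>\<gamma> * \<tau>\<close> times \<open>K\<close> after
  its adjoint.\<close>

definition pnorm :: "real \<Rightarrow> 'u \<Rightarrow> real" where
  "pnorm s w = s\<^sup>2 / (2 * \<tau>) * (norm w)\<^sup>2 - s\<^sup>2 * \<gamma> / 2 * (norm (adjoint K w))\<^sup>2"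

text \<open>\<open>energy\<close> without the feasibility term of \<open>x\<close>. Its descent
  leaves a residual at \<open>z\<close>, which later pays for that term.\<close>

definition core_energy :: "nat \<Rightarrow> real" where
  "core_energy t = 1 / (2 * \<gamma>) * (norm (z t - xs))\<^sup>2 + pnorm (a t) (v t - us)
    + m t * \<gamma> * (a t)\<^sup>2 * \<Lambda> / 4 * (norm (v t - us))\<^sup>2 + (a t)\<^sup>2 * gap (x t)"

lemma gradf_xs: "gradf xs = - adjoint K us"
  using stationary by (simp add: eq_neg_iff_add_eq_0)

text \<open>Stationarity and feasibility turn the linear term of \<open>gap\<close> into the
  constraint term of the Lagrangian.\<close>

lemma lagrangian_gap_eq: "lagrangian_gap f K b xs us p w = gap p"
proof -
  have "(p - xs) \<bullet> gradf xs = - ((K p - b) \<bullet> us)"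
    by (simp add: gradf_xs adjoint_inner[OF K_bounded_linear, symmetric] K.diff feasible)
  then show ?thesis
    by (simp add: lagrangian_gap_def lagrangian_def gap_def feasible inner_diff_left
        inner_commute[of us b] inner_commute[of w b])
qed

lemma energy_eq:
  "energy f K b Lf \<gamma> \<tau> a x z u v xs us t = core_energy t + a t * \<tau> / 2 * (norm (K (x t) - b))\<^sup>2"
  unfolding energy_def core_energy_def lagrangian_gap_eq pnorm_def m_def[symmetric]
  using tau_pos by (simp add: field_simps)

lemma gap_nonneg: "0 \<le> gap p"
  using convex_gradient_lower_bound[OF convex gradient, of xs p] by (simp add: gap_def)

text \<open>The left side of \<open>preconditioner_contraction\<close> is a square;
  \<open>c = \<gamma> * \<tau>\<close> is admissible because its product with the squared operator
  norm is \<open>\<nu>\<close>.\<close>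

lemma adjoint_norm_bound: "\<gamma> * \<tau> * (norm (adjoint K w))\<^sup>2 \<le> (norm w)\<^sup>2"
proof -
  have "0 \<le> (norm w)\<^sup>2 - \<gamma> * \<tau> * (norm (adjoint K w))\<^sup>2"
    using preconditioner_contraction[OF K_bounded_linear, of "\<gamma> * \<tau>" w] gamma_pos tau_pos gamma_tau nu
    by (meson mult_nonneg_nonneg less_imp_le order_trans zero_le_power2 eq_refl)
  then show ?thesis by simp
qed

lemma pnorm_factor: "pnorm s w = s\<^sup>2 / (2 * \<tau>) * ((norm w)\<^sup>2 - \<gamma> * \<tau> * (norm (adjoint K w))\<^sup>2)"
  using tau_pos by (simp add: pnorm_def field_simps)

lemma pnorm_nonneg: "0 \<le> pnorm s w"
  using adjoint_norm_bound[of w] tau_pos by (simp add: pnorm_factor)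

section \<open>One-step inequalities and descent of the energy\<close>

text \<open>The update makes \<open>K (z (Suc t)) - b\<close> a multiple of the preconditioner
  applied to the increment \<open>d\<close>. Polarising its quadratic form gives the telescoping
  difference plus \<open>pnorm s d\<close>, and this surplus dominates the residual by
  contraction.\<close>

lemma dual_step:
  "pnorm (a (Suc t)) (v (Suc t) - us) - pnorm (a (Suc t)) (v t - us)
      + \<tau> / 2 * (norm (K (z (Suc t)) - b))\<^sup>2
    \<le> a (Suc t) * ((v (Suc t) - us) \<bullet> (K (z (Suc t)) - b))"
proof -
  define s where "s = a (Suc t)"
  define d where "d = v (Suc t) - v t"
  define w where "w = v (Suc t) - us"
  have s: "s > 0" using a_ge_1[of "Suc t"] by (simp add: s_def)
  \<comment> \<open>\<open>zh t\<close> and \<open>z (Suc t)\<close> differ only in the dual iterate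
    that enters them.\<close>
  have zh: "zh t = z (Suc t) + (s * \<gamma>) *\<^sub>R adjoint K d"
    by (simp add: zh_eq z_eq d_def s_def adjK.diff scaleR_diff_right)
  have "d = (\<tau> / s) *\<^sub>R (K (zh t) - b)"
    by (simp add: v_eq d_def s_def)
  also have "K (zh t) - b = K (z (Suc t)) - b + (s * \<gamma>) *\<^sub>R K (adjoint K d)"
    unfolding zh by (simp add: K.add K.scaleR)
  finally have "(\<tau> / s) *\<^sub>R (K (z (Suc t)) - b + (s * \<gamma>) *\<^sub>R K (adjoint K d)) = d" by (rule sym)
  then have "(s / \<tau>) *\<^sub>R d = (s / \<tau>) *\<^sub>R (\<tau> / s) *\<^sub>R (K (z (Suc t)) - b + (s * \<gamma>) *\<^sub>R K (adjoint K d))"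
    by simp
  also have "\<dots> = K (z (Suc t)) - b + (s * \<gamma>) *\<^sub>R K (adjoint K d)"
    using s tau_pos by simp
  finally have res: "K (z (Suc t)) - b = (s / \<tau>) *\<^sub>R (d - (\<gamma> * \<tau>) *\<^sub>R K (adjoint K d))"
    using tau_pos s by (simp add: scaleR_diff_right algebra_simps)
  have "(norm (d - (\<gamma> * \<tau>) *\<^sub>R K (adjoint K d)))\<^sup>2 \<le> (norm d)\<^sup>2 - \<gamma> * \<tau> * (norm (adjoint K d))\<^sup>2"
    using gamma_pos tau_pos gamma_tau nu
    by (intro preconditioner_contraction[OF K_bounded_linear]) auto
  then have "s\<^sup>2 / (2 * \<tau>) * (norm (d - (\<gamma> * \<tau>) *\<^sub>R K (adjoint K d)))\<^sup>2 \<le> pnorm s d"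
    unfolding pnorm_factor using tau_pos by (intro mult_left_mono) auto
  moreover have "\<tau> / 2 * (norm (K (z (Suc t)) - b))\<^sup>2
      = s\<^sup>2 / (2 * \<tau>) * (norm (d - (\<gamma> * \<tau>) *\<^sub>R K (adjoint K d)))\<^sup>2"
    unfolding res norm_scaleR power_mult_distrib using tau_pos by (simp add: power_divide power2_eq_square)
  ultimately have feas: "\<tau> / 2 * (norm (K (z (Suc t)) - b))\<^sup>2 \<le> pnorm s d"
    by simp
  have polar: "2 * (p \<bullet> e) = (norm p)\<^sup>2 - (norm (p - e))\<^sup>2 + (norm e)\<^sup>2" for p e :: "'a::real_inner"
    unfolding power2_norm_eq_inner by (simp add: inner_diff inner_commute)
  have "s * (w \<bullet> (K (z (Suc t)) - b))
      = s\<^sup>2 / \<tau> * (w \<bullet> d - \<gamma> * \<tau> * (w \<bullet> K (adjoint K d)))"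
    unfolding res by (simp add: inner_diff_right power2_eq_square)
  also have "w \<bullet> K (adjoint K d) = adjoint K w \<bullet> adjoint K d"
    using adjoint_inner[OF K_bounded_linear, of "adjoint K d" w] by (simp add: inner_commute)
  also have "s\<^sup>2 / \<tau> * (w \<bullet> d - \<gamma> * \<tau> * (adjoint K w \<bullet> adjoint K d))
      = s\<^sup>2 / (2 * \<tau>) * (2 * (w \<bullet> d) - \<gamma> * \<tau> * (2 * (adjoint K w \<bullet> adjoint K d)))"
    using tau_pos by (simp add: field_simps)
  also have "\<dots> = pnorm s w - pnorm s (w - d) + pnorm s d"
    unfolding polar pnorm_factor adjK.diff by (simp add: algebra_simps)
  also have "w - d = v t - us" by (simp add: w_def d_def)
  finally show ?thesis using feas unfolding s_def w_def by linarith
qed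

lemma z_increment:
  "z (Suc t) - z t = - (a (Suc t) * \<gamma>) *\<^sub>R ((gradf (y t) - gradf xs) + adjoint K (v (Suc t) - us))"
  by (simp add: z_eq gradf_xs adjK.diff scaleR_add_right scaleR_diff_right)

text \<open>Expands the squared distance around \<open>z (Suc t)\<close>. The last product is the
  one bounded below in \<open>dual_step\<close>, so the couplings cancel on addition.\<close>

lemma primal_step:
  "1 / (2 * \<gamma>) * (norm (z (Suc t) - xs))\<^sup>2 = 1 / (2 * \<gamma>) * (norm (z t - xs))\<^sup>2
    - 1 / (2 * \<gamma>) * (norm (z (Suc t) - z t))\<^sup>2
    - a (Suc t) * ((gradf (y t) - gradf xs) \<bullet> (z (Suc t) - xs))
    - a (Suc t) * ((v (Suc t) - us) \<bullet> (K (z (Suc t)) - b))"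
proof -
  define s where "s = a (Suc t)"
  define q where "q = gradf (y t) - gradf xs"
  define p where "p = adjoint K (v (Suc t) - us)"
  define e where "e = z (Suc t) - z t"
  define r where "r = z (Suc t) - xs"
  have e: "e = - (s * \<gamma>) *\<^sub>R (q + p)"
    unfolding e_def s_def q_def p_def by (rule z_increment)
  have "r \<bullet> p = (v (Suc t) - us) \<bullet> (K (z (Suc t)) - b)"
    by (simp add: r_def p_def adjoint_inner[OF K_bounded_linear, symmetric] K.diff feasible inner_commute)
  moreover have "(norm (r - e))\<^sup>2 = (norm r)\<^sup>2 + (norm e)\<^sup>2 - 2 * (r \<bullet> e)"
    unfolding power2_norm_eq_inner by (simp add: inner_diff inner_commute)
  moreover have "r \<bullet> e = - s * \<gamma> * (q \<bullet> r) - s * \<gamma> * (r \<bullet> p)"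
    by (simp add: e inner_add_right algebra_simps inner_commute)
  moreover have "r - e = z t - xs" by (simp add: r_def e_def)
  ultimately show ?thesis
    unfolding s_def[symmetric] q_def[symmetric] e_def[symmetric] r_def[symmetric]
    using gamma_pos by (simp add: field_simps)
qed

text \<open>Nesterov's estimate: use the upper model at \<open>y t\<close> and split
  \<open>x (Suc t) - y t\<close> into directions towards \<open>x t\<close>, towards
  \<open>xs\<close> and from \<open>xs\<close> to \<open>z (Suc t)\<close>. Convexity handles the
  first two.\<close>

lemma gradient_step:
  "(a (Suc t))\<^sup>2 * gap (x (Suc t)) \<le> ((a (Suc t))\<^sup>2 - a (Suc t)) * gap (x t)
    - a (Suc t) / (2 * Lf) * (norm (gradf (y t) - gradf xs))\<^sup>2
    + a (Suc t) * ((gradf (y t) - gradf xs) \<bullet> (z (Suc t) - xs))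
    + Lf / 2 * (norm (z (Suc t) - z t))\<^sup>2"
proof -
  define s where "s = a (Suc t)"
  define q where "q = gradf (y t) - gradf xs"
  have s: "s \<ge> 1" using a_ge_1[of "Suc t"] by (simp add: s_def)
  have sq: "s\<^sup>2 * (1 / s) = s" "s\<^sup>2 * (1 - 1 / s) = s\<^sup>2 - s"
    using s by (simp_all add: power2_eq_square field_simps)
  have xy: "x (Suc t) - y t = (1 / s) *\<^sub>R (z (Suc t) - z t)"
    by (simp add: x_eq y_eq s_def scaleR_diff_right)
  have upper: "gap (x (Suc t)) \<le> gap (y t) + (x (Suc t) - y t) \<bullet> q + Lf / 2 * (norm (x (Suc t) - y t))\<^sup>2"
    using lipschitz_gradient_upper_bound[OF gradient smooth, of "x (Suc t)" "y t"]
    by (simp add: gap_def q_def inner_diff)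
  have lower: "gap (y t) + (x t - y t) \<bullet> q \<le> gap (x t)"
    using convex_gradient_lower_bound[OF convex gradient, of "y t" "x t"]
    by (simp add: gap_def q_def inner_diff)
  \<comment> \<open>The gradient-gap inequality replaces the tangent inequality here;
    \<open>dual_regularity\<close> spends its square.\<close>
  have lower': "gap (y t) + (xs - y t) \<bullet> q \<le> - (1 / (2 * Lf) * (norm q)\<^sup>2)"
    using convex_smooth_gradient_gap[OF convex gradient smooth Lf_pos, of xs "y t"]
    by (simp add: gap_def q_def inner_diff norm_minus_commute)
  have "s\<^sup>2 * (norm (x (Suc t) - y t))\<^sup>2 = (norm (z (Suc t) - z t))\<^sup>2"
    unfolding xy using s by (simp add: power_mult_distrib power_divide)
  then have quad: "s\<^sup>2 * (Lf / 2 * (norm (x (Suc t) - y t))\<^sup>2) = Lf / 2 * (norm (z (Suc t) - z t))\<^sup>2"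
    by (simp add: field_simps)
  have "x (Suc t) - y t = (1 - 1 / s) *\<^sub>R (x t - y t) + (1 / s) *\<^sub>R (xs - y t) + (1 / s) *\<^sub>R (z (Suc t) - xs)"
    by (simp add: x_eq s_def algebra_simps)
  then have "(x (Suc t) - y t) \<bullet> q
      = (1 - 1 / s) * ((x t - y t) \<bullet> q) + 1 / s * ((xs - y t) \<bullet> q) + 1 / s * ((z (Suc t) - xs) \<bullet> q)"
    by (simp only: inner_add_left inner_scaleR_left)
  then have "gap (y t) + (x (Suc t) - y t) \<bullet> q
      = (1 - 1 / s) * (gap (y t) + (x t - y t) \<bullet> q) + 1 / s * (gap (y t) + (xs - y t) \<bullet> q)
        + 1 / s * ((z (Suc t) - xs) \<bullet> q)"
    by (simp add: algebra_simps)
  also have "\<dots> \<le> (1 - 1 / s) * gap (x t) + 1 / s * (- (1 / (2 * Lf) * (norm q)\<^sup>2))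
        + 1 / s * ((z (Suc t) - xs) \<bullet> q)"
    using s by (intro add_mono mult_left_mono lower lower') auto
  finally have "gap (x (Suc t)) \<le> (1 - 1 / s) * gap (x t) + 1 / s * (- (1 / (2 * Lf) * (norm q)\<^sup>2))
        + 1 / s * ((z (Suc t) - xs) \<bullet> q) + Lf / 2 * (norm (x (Suc t) - y t))\<^sup>2"
    using upper by linarith
  then have "s\<^sup>2 * gap (x (Suc t)) \<le> s\<^sup>2 * ((1 - 1 / s) * gap (x t) + 1 / s * (- (1 / (2 * Lf) * (norm q)\<^sup>2))
        + 1 / s * ((z (Suc t) - xs) \<bullet> q) + Lf / 2 * (norm (x (Suc t) - y t))\<^sup>2)"
    by (intro mult_left_mono) auto
  also have "\<dots> = s\<^sup>2 * (1 - 1 / s) * gap (x t) + s\<^sup>2 * (1 / s) * (- (1 / (2 * Lf) * (norm q)\<^sup>2))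
        + s\<^sup>2 * (1 / s) * ((z (Suc t) - xs) \<bullet> q) + s\<^sup>2 * (Lf / 2 * (norm (x (Suc t) - y t))\<^sup>2)"
    by (simp only: distrib_left mult.assoc)
  also have "\<dots> = (s\<^sup>2 - s) * gap (x t) - s / (2 * Lf) * (norm q)\<^sup>2 + s * (q \<bullet> (z (Suc t) - xs))
        + Lf / 2 * (norm (z (Suc t) - z t))\<^sup>2"
    unfolding sq quad by (simp add: inner_commute)
  finally show ?thesis unfolding s_def q_def .
qed

text \<open>The descent terms left over from the smoothness inequality control \<open>adjoint K (v - us)\<close>, and
  hence \<open>v - us\<close>; this is what pays for the growth of \<open>a\<close>.\<close>

lemma dual_regularity:
  "m (Suc t) * \<gamma> * (a (Suc t))\<^sup>2 * \<Lambda> / 4 * (norm (v (Suc t) - us))\<^sup>2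
    \<le> (1 / (2 * \<gamma>) - Lf / 2) * (norm (z (Suc t) - z t))\<^sup>2
      + a (Suc t) / (2 * Lf) * (norm (gradf (y t) - gradf xs))\<^sup>2"
proof -
  define s where "s = a (Suc t)"
  define q where "q = gradf (y t) - gradf xs"
  define p where "p = adjoint K (v (Suc t) - us)"
  define \<mu> where "\<mu> = m (Suc t)"
  have s: "s > 0" using a_ge_1[of "Suc t"] by (simp add: s_def)
  have \<mu>: "0 \<le> \<mu>" "\<mu> \<le> 1 / 2" "\<mu> \<le> 1 / (2 * s * \<gamma> * Lf)"
    using m_bounds[of "Suc t"] unfolding \<mu>_def s_def by simp_all
  have "\<Lambda> * (norm (v (Suc t) - us))\<^sup>2 \<le> (norm p)\<^sup>2"
    unfolding p_def by (intro lambda_min_pos_bound v_diff_range us_range)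
  then have "s\<^sup>2 * \<gamma> * (\<mu> / 4) * (\<Lambda> * (norm (v (Suc t) - us))\<^sup>2) \<le> s\<^sup>2 * \<gamma> * (\<mu> / 4) * (norm p)\<^sup>2"
    using \<mu> gamma_pos by (intro mult_left_mono) auto
  also have "\<dots> = s\<^sup>2 * \<gamma> * (\<mu> / 4 * (norm p)\<^sup>2)" by simp
  also have "\<dots> \<le> s\<^sup>2 * \<gamma> * (1 / 4 * (norm (q + p))\<^sup>2 + 1 / (2 * s * \<gamma> * Lf) * (norm q)\<^sup>2)"
    using gamma_pos by (intro mult_left_mono young_parallel_sum[OF \<mu>]) auto
  also have "\<dots> = 1 / (4 * \<gamma>) * ((s * \<gamma>)\<^sup>2 * (norm (q + p))\<^sup>2) + s / (2 * Lf) * (norm q)\<^sup>2"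
    using gamma_pos s Lf_pos by (simp add: field_simps power2_eq_square)
  also have "(s * \<gamma>)\<^sup>2 * (norm (q + p))\<^sup>2 = (norm (z (Suc t) - z t))\<^sup>2"
    unfolding z_increment s_def q_def p_def by (simp add: power_mult_distrib)
  \<comment> \<open>Comparing the coefficients is exactly the step size condition
    \<open>\<gamma> * Lf \<le> 1 / 2\<close>.\<close>
  also have "1 / (4 * \<gamma>) * (norm (z (Suc t) - z t))\<^sup>2 \<le> (1 / (2 * \<gamma>) - Lf / 2) * (norm (z (Suc t) - z t))\<^sup>2"
    using gamma_Lf gamma_pos by (intro mult_right_mono) (auto simp: field_simps)
  finally show ?thesis unfolding s_def q_def \<mu>_def by (simp add: mult_ac)
qed

text \<open>Adding the three step inequalities cancels the couplings. \<open>dual_regularity\<close>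
  turns the leftover squares into the dual term at \<open>Suc t\<close>; \<open>growth\<close> and
  \<open>gap\<close> settle the mismatch of weights.\<close>

lemma core_energy_descent:
  "core_energy (Suc t) + \<tau> / 2 * (norm (K (z (Suc t)) - b))\<^sup>2 \<le> core_energy t"
proof -
  define w where "w = v t - us"
  \<comment> \<open>After dropping the adjoint part, the extra dual term of
    \<open>core_energy t\<close> pays for the larger weight.\<close>
  have growth: "pnorm (a (Suc t)) w \<le> pnorm (a t) w + m t * \<gamma> * (a t)\<^sup>2 * \<Lambda> / 4 * (norm w)\<^sup>2"
  proof -
    have "0 \<le> (a (Suc t))\<^sup>2 - (a t)\<^sup>2"
      using a_mono[of t] a_ge_1[of t] by (simp add: power_mono)
    then have "((a (Suc t))\<^sup>2 - (a t)\<^sup>2) / (2 * \<tau>) * ((norm w)\<^sup>2 - \<gamma> * \<tau> * (norm (adjoint K w))\<^sup>2)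
        \<le> ((a (Suc t))\<^sup>2 - (a t)\<^sup>2) / (2 * \<tau>) * (norm w)\<^sup>2"
      using tau_pos gamma_pos by (intro mult_left_mono) auto
    also have "\<dots> \<le> (\<gamma> * \<tau> * m t * \<Lambda> * (a t)\<^sup>2 / 2) / (2 * \<tau>) * (norm w)\<^sup>2"
      using a_Suc_sq_growth[of t] tau_pos by (intro mult_right_mono divide_right_mono) auto
    also have "\<dots> = m t * \<gamma> * (a t)\<^sup>2 * \<Lambda> / 4 * (norm w)\<^sup>2"
      using tau_pos by simp
    finally show ?thesis
      unfolding pnorm_factor diff_divide_distrib left_diff_distrib[of "_ / _"] by linarith
  qed
  have gap: "((a (Suc t))\<^sup>2 - a (Suc t)) * gap (x t) \<le> (a t)\<^sup>2 * gap (x t)"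
    using a_Suc_sq gap_nonneg by (rule mult_right_mono)
  have "(1 / (2 * \<gamma>) - Lf / 2) * (norm (z (Suc t) - z t))\<^sup>2
      = 1 / (2 * \<gamma>) * (norm (z (Suc t) - z t))\<^sup>2 - Lf / 2 * (norm (z (Suc t) - z t))\<^sup>2"
    by (rule left_diff_distrib)
  then show ?thesis
    using growth gap dual_step[of t] primal_step[of t] gradient_step[of t] dual_regularity[of t]
    unfolding core_energy_def w_def by linarith
qed

text \<open>Convexity of the squared residual under averaging, weighted by \<open>a (Suc t)\<close>,
  charges \<open>\<tau> / 2\<close> times the squared residual at \<open>z (Suc t)\<close>, which is
  what the core descent provides.\<close>

lemma energy_descent:
  "energy f K b Lf \<gamma> \<tau> a x z u v xs us (Suc t) \<le> energy f K b Lf \<gamma> \<tau> a x z u v xs us t"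
proof -
  define s where "s = a (Suc t)"
  have s: "s \<ge> 1" using a_ge_1 by (simp add: s_def)
  \<comment> \<open>Leads to \<open>a (Suc t) - 1 \<le> a t\<close>, the comparison of weights for
    the old residual.\<close>
  have "(s - 1)\<^sup>2 \<le> s\<^sup>2 - s" using s by (simp add: power2_eq_square algebra_simps)
  then have "(s - 1)\<^sup>2 \<le> (a t)\<^sup>2" using a_Suc_sq[of t] by (simp add: s_def)
  then have sa: "s - 1 \<le> a t"
    by (rule power2_le_imp_le) (rule order_trans[OF zero_le_one a_ge_1])
  have "K (x (Suc t)) - b = (1 - 1 / s) *\<^sub>R (K (x t) - b) + (1 / s) *\<^sub>R (K (z (Suc t)) - b)"
    by (simp add: x_eq s_def K.add K.diff K.scaleR algebra_simps)
  then have "s * (norm (K (x (Suc t)) - b))\<^sup>2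
      \<le> s * ((1 - 1 / s) * (norm (K (x t) - b))\<^sup>2 + 1 / s * (norm (K (z (Suc t)) - b))\<^sup>2)"
    using power2_norm_convex_combination[of "1 / s" "K (x t) - b" "K (z (Suc t)) - b"] s by simp
  also have "\<dots> = (s - 1) * (norm (K (x t) - b))\<^sup>2 + (norm (K (z (Suc t)) - b))\<^sup>2"
    using s by (simp add: field_simps)
  also have "(s - 1) * (norm (K (x t) - b))\<^sup>2 \<le> a t * (norm (K (x t) - b))\<^sup>2"
    using sa by (rule mult_right_mono) simp
  finally have "\<tau> / 2 * (s * (norm (K (x (Suc t)) - b))\<^sup>2)
      \<le> \<tau> / 2 * (a t * (norm (K (x t) - b))\<^sup>2 + (norm (K (z (Suc t)) - b))\<^sup>2)"
    using tau_pos by (intro mult_left_mono) auto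
  then have "a (Suc t) * \<tau> / 2 * (norm (K (x (Suc t)) - b))\<^sup>2
      \<le> a t * \<tau> / 2 * (norm (K (x t) - b))\<^sup>2 + \<tau> / 2 * (norm (K (z (Suc t)) - b))\<^sup>2"
    by (simp add: s_def algebra_simps)
  with core_energy_descent[of t] show ?thesis unfolding energy_eq by linarith
qed

section \<open>Rates, boundedness and feasibility\<close>

lemma core_energy_parts:
  shows "1 / (2 * \<gamma>) * (norm (z t - xs))\<^sup>2 \<le> core_energy t"
    and "m t * \<gamma> * (a t)\<^sup>2 * \<Lambda> / 4 * (norm (v t - us))\<^sup>2 \<le> core_energy t"
    and "(a t)\<^sup>2 * gap (x t) \<le> core_energy t"
    and "0 \<le> core_energy t"
proof -
  have "0 \<le> 1 / (2 * \<gamma>) * (norm (z t - xs))\<^sup>2" using gamma_pos by simp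
  moreover have "0 \<le> m t * \<gamma> * (a t)\<^sup>2 * \<Lambda> / 4 * (norm (v t - us))\<^sup>2"
    using gamma_pos lambda_pos m_bounds(1)[of t] by simp
  moreover have "0 \<le> (a t)\<^sup>2 * gap (x t)" using gap_nonneg by simp
  ultimately show "1 / (2 * \<gamma>) * (norm (z t - xs))\<^sup>2 \<le> core_energy t"
      "m t * \<gamma> * (a t)\<^sup>2 * \<Lambda> / 4 * (norm (v t - us))\<^sup>2 \<le> core_energy t"
      "(a t)\<^sup>2 * gap (x t) \<le> core_energy t" "0 \<le> core_energy t"
    using pnorm_nonneg[of "a t" "v t - us"] unfolding core_energy_def by linarith+
qed

lemma core_energy_decseq: "decseq core_energy"
proof (rule decseq_SucI)
  fix t
  have "0 \<le> \<tau> / 2 * (norm (K (z (Suc t)) - b))\<^sup>2" using tau_pos by simp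
  with core_energy_descent[of t] show "core_energy (Suc t) \<le> core_energy t" by linarith
qed

lemma core_energy_le: "core_energy t \<le> core_energy 0"
  using core_energy_decseq by (simp add: decseq_def)

lemma core_energy_convergent: "convergent core_energy"
proof (rule Bseq_monoseq_convergent)
  show "Bseq core_energy"
    using core_energy_le core_energy_parts(4) by (intro BseqI'[of _ "core_energy 0"]) simp
  show "monoseq core_energy"
    using core_energy_decseq by (simp add: monoseq_iff)
qed

lemma energy_decseq: "decseq (energy f K b Lf \<gamma> \<tau> a x z u v xs us)"
  by (rule decseq_SucI) (rule energy_descent)

lemma gap_rate: "(\<lambda>t. lagrangian_gap f K b xs us (x t) (u t)) \<in> O(\<lambda>t. 1 / (real t)\<^sup>2)"
proof -
  obtain c where c: "c > 0" "\<And>t. c * (real t + 1) \<le> a t" using a_ge_linear by blast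
  show ?thesis
  proof (rule bigoI[of _ "core_energy 0 / c\<^sup>2"])
    show "\<forall>\<^sub>F t in at_top. norm (lagrangian_gap f K b xs us (x t) (u t))
        \<le> core_energy 0 / c\<^sup>2 * norm (1 / (real t)\<^sup>2)"
      using eventually_gt_at_top[of 0]
    proof eventually_elim
      case (elim t)
      have "c * real t \<le> a t" using c(1) c(2)[of t] by (simp add: distrib_left)
      then have "(c * real t)\<^sup>2 * gap (x t) \<le> (a t)\<^sup>2 * gap (x t)"
        using c(1) gap_nonneg by (intro mult_right_mono power_mono) auto
      also have "\<dots> \<le> core_energy 0"
        using core_energy_parts(3) core_energy_le by (rule order_trans)
      finally have "gap (x t) \<le> core_energy 0 / (c * real t)\<^sup>2"
        using c(1) elim by (simp add: pos_le_divide_eq mult.commute)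
      then show ?case
        using gap_nonneg by (simp add: lagrangian_gap_eq power_mult_distrib)
    qed
  qed
qed

lemma dual_rate: "(\<lambda>t. (norm (v t - us))\<^sup>2) \<in> O(\<lambda>t. 1 / real t)"
proof -
  obtain c where c: "c > 0" "\<And>t. c * (real t + 1) \<le> a t" using a_ge_linear by blast
  \<comment> \<open>The factor \<open>1 / 8\<close> combines \<open>1 / 4\<close> from the dual term
    with the lower bound \<open>1 / (2 * a t)\<close> on \<open>m t\<close>.\<close>
  define D where "D = \<gamma> * \<Lambda> * c / 8"
  have D: "D > 0" using gamma_pos lambda_pos c by (simp add: D_def)
  show ?thesis
  proof (rule bigoI[of _ "core_energy 0 / D"])
    show "\<forall>\<^sub>F t in at_top. norm ((norm (v t - us))\<^sup>2) \<le> core_energy 0 / D * norm (1 / real t)"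
      using eventually_gt_at_top[of 0]
    proof eventually_elim
      case (elim t)
      have a: "a t > 0" using a_ge_1[of t] by simp
      have "c * real t \<le> a t" using c(1) c(2)[of t] by (simp add: distrib_left)
      then have "\<gamma> * \<Lambda> / 8 * (c * real t) \<le> \<gamma> * \<Lambda> / 8 * a t"
        using gamma_pos lambda_pos by (intro mult_left_mono) auto
      also have "\<dots> = 1 / (2 * a t) * (\<gamma> * (a t)\<^sup>2 * \<Lambda> / 4)"
        using a by (simp add: power2_eq_square)
      also have "\<dots> \<le> m t * (\<gamma> * (a t)\<^sup>2 * \<Lambda> / 4)"
        using gamma_pos lambda_pos by (intro mult_right_mono m_bounds) auto
      finally have "D * real t \<le> m t * \<gamma> * (a t)\<^sup>2 * \<Lambda> / 4"
        by (simp add: D_def mult_ac)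
      then have "D * real t * (norm (v t - us))\<^sup>2 \<le> m t * \<gamma> * (a t)\<^sup>2 * \<Lambda> / 4 * (norm (v t - us))\<^sup>2"
        by (rule mult_right_mono) simp
      also have "\<dots> \<le> core_energy 0"
        using core_energy_parts(2) core_energy_le by (rule order_trans)
      finally have "(norm (v t - us))\<^sup>2 \<le> core_energy 0 / (D * real t)"
        using D elim by (simp add: pos_le_divide_eq mult.commute)
      then show ?case by simp
    qed
  qed
qed

lemma z_bound: "\<exists>M. \<forall>t. norm (z t) \<le> M"
proof -
  define M where "M = sqrt (2 * \<gamma> * core_energy 0)"
  have "norm (z t - xs) \<le> M" for t
  proof -
    have "1 / (2 * \<gamma>) * (norm (z t - xs))\<^sup>2 \<le> core_energy 0"
      using core_energy_parts(1) core_energy_le by (rule order_trans)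
    then have "(norm (z t - xs))\<^sup>2 \<le> 2 * \<gamma> * core_energy 0"
      using gamma_pos by (simp add: field_simps)
    then show ?thesis unfolding M_def by (rule real_le_rsqrt)
  qed
  then have "norm (z t) \<le> M + norm xs" for t
    using norm_triangle_ineq[of "z t - xs" xs] by (smt (verit) diff_add_cancel)
  then show ?thesis by blast
qed

lemma z_bounded: "bounded (range z)"
  using z_bound by (auto simp: bounded_iff)

lemma x_bound: "\<exists>M. \<forall>t. norm (x t) \<le> M"
proof -
  obtain M where M: "\<And>t. norm (z t) \<le> M" using z_bound by blast
  have "norm (x t) \<le> M" for t
  proof (induction t)
    case (Suc t)
    define r where "r = 1 / a (Suc t)"
    have r: "0 \<le> r" "r \<le> 1" using a_ge_1[of "Suc t"] by (auto simp: r_def)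
    have "norm (x (Suc t)) \<le> norm ((1 - r) *\<^sub>R x t) + norm (r *\<^sub>R z (Suc t))"
      unfolding x_eq r_def by (rule norm_triangle_ineq)
    also have "\<dots> \<le> (1 - r) * M + r * M"
      using r Suc M[of "Suc t"] by (simp add: add_mono mult_left_mono)
    finally show ?case by (simp add: algebra_simps)
  qed (simp add: x0 M)
  then show ?thesis by blast
qed

text \<open>Core descent bounds the squared residual by a multiple of an energy difference, and
  these differences vanish because the energy converges.\<close>

lemma z_feasibility: "(\<lambda>t. norm (K (z t) - b)) \<longlonglongrightarrow> 0"
proof -
  obtain L where L: "core_energy \<longlonglongrightarrow> L" using core_energy_convergent convergent_def by blast
  have "(\<lambda>t. 2 / \<tau> * (core_energy t - core_energy (Suc t))) \<longlonglongrightarrow> 2 / \<tau> * (L - L)"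
    by (intro tendsto_intros L LIMSEQ_Suc)
  then have lim: "(\<lambda>t. 2 / \<tau> * (core_energy t - core_energy (Suc t))) \<longlonglongrightarrow> 0" by simp
  have "(norm (K (z (Suc t)) - b))\<^sup>2 \<le> 2 / \<tau> * (core_energy t - core_energy (Suc t))" for t
    using core_energy_descent[of t] tau_pos by (simp add: field_simps)
  then have "(\<lambda>t. norm (K (z (Suc t)) - b)) \<longlonglongrightarrow> 0"
    by (rule LIMSEQ_zero_squeeze_power2[OF norm_ge_zero _ lim])
  then show ?thesis by (rule LIMSEQ_imp_Suc)
qed

lemma inverse_a_tendsto: "(\<lambda>t. 1 / a t) \<longlonglongrightarrow> 0"
proof -
  obtain c where c: "c > 0" "\<And>t. c * (real t + 1) \<le> a t" using a_ge_linear by blast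
  have upper: "1 / a t \<le> 1 / c * inverse (real (Suc t))" for t
  proof -
    have "1 / a t \<le> 1 / (c * (real t + 1))"
      using c a_ge_1[of t] by (intro divide_left_mono) auto
    then show ?thesis by (simp add: divide_inverse add.commute)
  qed
  have lower: "0 \<le> 1 / a t" for t using a_ge_1[of t] by simp
  have "(\<lambda>t. 1 / c * inverse (real (Suc t))) \<longlonglongrightarrow> 0"
    by (intro tendsto_mult_right_zero LIMSEQ_inverse_real_of_nat)
  then show ?thesis by (rule LIMSEQ_zero_squeeze[OF lower upper])
qed

text \<open>The last term of the full energy stays bounded while its weight \<open>a t\<close> tends
  to infinity.\<close>

lemma x_feasibility: "(\<lambda>t. norm (K (x t) - b)) \<longlonglongrightarrow> 0"
proof -
  define C where "C = energy f K b Lf \<gamma> \<tau> a x z u v xs us 0"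
  have "(norm (K (x t) - b))\<^sup>2 \<le> 2 * C / \<tau> * (1 / a t)" for t
  proof -
    have "a t * \<tau> / 2 * (norm (K (x t) - b))\<^sup>2 \<le> energy f K b Lf \<gamma> \<tau> a x z u v xs us t"
      using core_energy_parts(4) by (simp add: energy_eq)
    also have "\<dots> \<le> C" unfolding C_def using energy_decseq by (auto simp: decseq_def)
    finally show ?thesis using tau_pos a_ge_1[of t] by (simp add: field_simps)
  qed
  moreover have "(\<lambda>t. 2 * C / \<tau> * (1 / a t)) \<longlonglongrightarrow> 0"
    by (intro tendsto_mult_right_zero inverse_a_tendsto)
  ultimately show ?thesis
    by (rule LIMSEQ_zero_squeeze_power2[OF norm_ge_zero])
qed

lemma gap_tendsto: "(\<lambda>t. gap (x t)) \<longlonglongrightarrow> 0"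
proof -
  have "gap (x t) \<le> core_energy 0 * (1 / a t)" for t
  proof -
    have "a t * gap (x t) \<le> (a t)\<^sup>2 * gap (x t)"
      using a_ge_1[of t] gap_nonneg by (intro mult_right_mono) (auto simp: power2_eq_square)
    also have "\<dots> \<le> core_energy 0"
      using core_energy_parts(3) core_energy_le by (rule order_trans)
    finally show ?thesis using a_ge_1[of t] by (simp add: field_simps)
  qed
  moreover have "(\<lambda>t. core_energy 0 * (1 / a t)) \<longlonglongrightarrow> 0"
    by (intro tendsto_mult_right_zero inverse_a_tendsto)
  ultimately show ?thesis
    by (rule LIMSEQ_zero_squeeze[OF gap_nonneg])
qed

section \<open>Weak cluster points and weak convergence\<close>

lemma gap_feasible: "K p = b \<Longrightarrow> gap p = f p - f xs"
  \<comment> \<open>With dual argument 0 the second Lagrangian value is \<open>f xs\<close>.\<close>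
  using lagrangian_gap_eq[of p 0] by (simp add: lagrangian_gap_def lagrangian_def feasible inner_commute)

lemma is_arg_minI: "K p = b \<Longrightarrow> f p = f xs \<Longrightarrow> is_arg_min f (\<lambda>p. K p = b) p"
  unfolding is_arg_min_def using gap_nonneg gap_feasible by (metis diff_ge_0_iff_ge not_le)

text \<open>The residuals tend to 0 in norm and, through the adjoint, weakly to
  \<open>K l - b\<close>. For the value, the tangent at \<open>l\<close> is weakly continuous and
  bounds \<open>gap\<close> below, so \<open>gap l\<close> is at most the limit 0.\<close>

lemma weak_cluster_point_optimal:
  assumes G: "G \<le> sequentially" "G \<noteq> bot" and lim: "\<And>p. ((\<lambda>t. x t \<bullet> p) \<longlongrightarrow> l \<bullet> p) G"
  shows "K l = b" "f l = f xs"
proof -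
  define w where "w = K l - b"
  have "((\<lambda>t. (K (x t) - b) \<bullet> w) \<longlongrightarrow> 0 \<bullet> w) G"
    using tendsto_norm_zero_cancel[OF x_feasibility] G(1)
    by (intro tendsto_inner tendsto_const) (rule tendsto_mono)
  moreover have "((\<lambda>t. x t \<bullet> adjoint K w - b \<bullet> w) \<longlongrightarrow> l \<bullet> adjoint K w - b \<bullet> w) G"
    by (intro tendsto_diff lim tendsto_const)
  ultimately have "w \<bullet> w = 0"
    using tendsto_unique[OF G(2)]
    by (fastforce simp: adjoint_inner[OF K_bounded_linear, symmetric] inner_diff_left w_def)
  then show Kl: "K l = b" by (simp add: w_def)
  define q where "q = gradf l - gradf xs"
  have "((\<lambda>t. gap l + (x t \<bullet> q - l \<bullet> q)) \<longlongrightarrow> gap l + (l \<bullet> q - l \<bullet> q)) G"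
    by (intro tendsto_intros lim)
  moreover have "((\<lambda>t. gap (x t)) \<longlongrightarrow> 0) G"
    using G(1) gap_tendsto by (rule tendsto_mono)
  moreover have "gap l + (x t \<bullet> q - l \<bullet> q) \<le> gap (x t)" for t
    using convex_gradient_lower_bound[OF convex gradient, of l "x t"]
    by (simp add: gap_def q_def inner_diff)
  ultimately have "gap l \<le> 0"
    using tendsto_le[OF G(2)] by fastforce
  then show "f l = f xs"
    using gap_nonneg[of l] gap_feasible[OF Kl] by simp
qed

text \<open>A vanishing gap forces equal gradients by the gradient-gap inequality, so
  \<open>us\<close> is a multiplier for \<open>l\<close> as well.\<close>

lemma optimal_stationary:
  assumes "K l = b" "f l = f xs"
  shows "0 = gradf l + adjoint K us"
proof -
  have "gap l = 0" using assms gap_feasible by simp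
  then have "1 / (2 * Lf) * (norm (gradf l - gradf xs))\<^sup>2 \<le> 0"
    using convex_smooth_gradient_gap[OF convex gradient smooth Lf_pos, of l xs]
    by (simp add: gap_def)
  then have "gradf l = gradf xs" using Lf_pos by (simp add: divide_le_0_iff)
  then show ?thesis using stationary by simp
qed

text \<open>The energies at two solutions with the same multiplier differ by a function that is affine in
  \<open>z\<close>; since both energies converge, so does \<open>z t \<bullet> (l - xs)\<close>.\<close>

lemma x_inner_convergent:
  assumes l: "K l = b" "f l = f xs"
  shows "convergent (\<lambda>t. x t \<bullet> (l - xs))"
proof -
  interpret l: apapc_saddle f gradf K b Lf \<gamma> \<tau> \<nu> a x y zh z u v l us
    by unfold_locales (use optimal_stationary[OF l] us_range l in auto)
  have "l.gap p = gap p" for p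
    using lagrangian_gap_eq[of p 0] l.lagrangian_gap_eq[of p 0] l feasible
    by (simp add: lagrangian_gap_def lagrangian_def)
  then have "core_energy t - l.core_energy t
      = 1 / (2 * \<gamma>) * ((norm (z t - xs))\<^sup>2 - (norm (z t - l))\<^sup>2)" for t
    unfolding core_energy_def l.core_energy_def pnorm_def l.pnorm_def by (simp add: algebra_simps)
  moreover have "(norm (p - xs))\<^sup>2 - (norm (p - l))\<^sup>2 = 2 * (p \<bullet> (l - xs)) + ((norm xs)\<^sup>2 - (norm l)\<^sup>2)" for p
    unfolding power2_norm_eq_inner by (simp add: inner_diff inner_commute)
  ultimately have eq: "z t \<bullet> (l - xs)
      = \<gamma> * (core_energy t - l.core_energy t) - ((norm xs)\<^sup>2 - (norm l)\<^sup>2) / 2" for t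
    using gamma_pos by (simp add: field_simps)
  obtain c c' where "core_energy \<longlonglongrightarrow> c" "l.core_energy \<longlonglongrightarrow> c'"
    using core_energy_convergent l.core_energy_convergent convergent_def by blast
  then have "(\<lambda>t. z t \<bullet> (l - xs)) \<longlonglongrightarrow> \<gamma> * (c - c') - ((norm xs)\<^sup>2 - (norm l)\<^sup>2) / 2"
    unfolding eq by (intro tendsto_intros)
  \<comment> \<open>Pairing with \<open>l - xs\<close> makes \<open>x\<close> a scalar average of
    \<open>z\<close>, and \<open>a_le\<close> keeps its weights large enough.\<close>
  then have "(\<lambda>t. x t \<bullet> (l - xs)) \<longlonglongrightarrow> \<gamma> * (c - c') - ((norm xs)\<^sup>2 - (norm l)\<^sup>2) / 2"
    by (rule weighted_average_tendsto[where a = a, rotated 3])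
      (use a_ge_1 a_le in \<open>auto simp: x_eq inner_add_left\<close>)
  then show ?thesis by (rule convergentI)
qed

text \<open>Two cluster points coincide: pairing \<open>x t\<close> with their difference gives a
  convergent sequence, so its limits along both filters agree. If convergence failed, the indices
  staying away would yield another cluster point.\<close>

lemma weak_limit_exists:
  "\<exists>l. K l = b \<and> f l = f xs \<and> (\<forall>p. (\<lambda>t. x t \<bullet> p) \<longlonglongrightarrow> l \<bullet> p)"
proof -
  obtain M where M: "\<And>t. norm (x t) \<le> M" using x_bound by blast
  obtain G l where G: "G \<le> sequentially" "G \<noteq> bot" "\<And>p. ((\<lambda>t. x t \<bullet> p) \<longlongrightarrow> l \<bullet> p) G"
    using bounded_imp_weak_cluster_point[where X = x, OF sequentially_bot M] by blast
  note l = weak_cluster_point_optimal[OF G]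
  interpret l: apapc_saddle f gradf K b Lf \<gamma> \<tau> \<nu> a x y zh z u v l us
    by unfold_locales (use optimal_stationary[OF l] us_range l in auto)
  have unique: "l' = l"
    if H: "H \<le> sequentially" "H \<noteq> bot" "\<And>p. ((\<lambda>t. x t \<bullet> p) \<longlongrightarrow> l' \<bullet> p) H" for H l'
  proof -
    note l' = l.weak_cluster_point_optimal[OF H]
    obtain c where c: "(\<lambda>t. x t \<bullet> (l' - l)) \<longlonglongrightarrow> c"
      using l.x_inner_convergent[OF l'] convergent_def by blast
    have "l \<bullet> (l' - l) = c"
      using tendsto_unique[OF G(2) G(3) tendsto_mono[OF G(1) c]] .
    moreover have "l' \<bullet> (l' - l) = c"
      using tendsto_unique[OF H(2) H(3) tendsto_mono[OF H(1) c]] .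
    ultimately have "(l' - l) \<bullet> (l' - l) = 0" by (simp only: inner_diff_left diff_self)
    then show ?thesis by simp
  qed
  have "(\<lambda>t. x t \<bullet> p) \<longlonglongrightarrow> l \<bullet> p" for p
  proof (rule tendstoI, rule ccontr)
    fix e :: real assume e: "0 < e"
    define far where "far = {t. \<not> dist (x t \<bullet> p) (l \<bullet> p) < e}"
    define F where "F = inf sequentially (principal far)"
    assume "\<not> (\<forall>\<^sub>F t in sequentially. dist (x t \<bullet> p) (l \<bullet> p) < e)"
    then have "F \<noteq> bot"
      by (auto simp: F_def far_def trivial_limit_def eventually_inf_principal)
    from bounded_imp_weak_cluster_point[where X = x, OF this M] obtain H l' where
      H: "H \<le> F" "H \<noteq> bot" "\<And>q. ((\<lambda>t. x t \<bullet> q) \<longlongrightarrow> l' \<bullet> q) H" by blast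
    have "H \<le> sequentially" using H(1) by (simp add: F_def)
    then have "l' = l" using unique H by blast
    then have "\<forall>\<^sub>F t in H. dist (x t \<bullet> p) (l \<bullet> p) < e"
      using H(3)[of p] e by (auto dest: tendstoD)
    moreover have "\<forall>\<^sub>F t in H. t \<in> far"
      using H(1) by (auto simp: F_def le_principal)
    ultimately have "\<forall>\<^sub>F t in H. False"
      by eventually_elim (simp add: far_def)
    then show False using H(2) by (simp add: trivial_limit_def)
  qed
  with l show ?thesis by blast
qed

text \<open>\<open>y t\<close> and \<open>x (Suc t)\<close> differ by \<open>1 / a (Suc t)\<close>
  times a bounded increment of \<open>z\<close>, so they share a weak limit. Riesz reduces
  functionals to inner products.\<close>

lemma weak_convergence:
  "\<exists>l. is_arg_min f (\<lambda>p. K p = b) l \<and> weakly_converges x l \<and> weakly_converges y l"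
proof -
  obtain l where l: "K l = b" "f l = f xs" "\<And>p. (\<lambda>t. x t \<bullet> p) \<longlonglongrightarrow> l \<bullet> p"
    using weak_limit_exists by blast
  obtain M where M: "\<And>t. norm (z t) \<le> M" using z_bound by blast
  have "(\<lambda>t. y t - x (Suc t)) \<longlonglongrightarrow> 0"
  proof (rule tendsto_norm_zero_cancel, rule LIMSEQ_zero_squeeze[OF norm_ge_zero])
    show "norm (y t - x (Suc t)) \<le> 2 * M * (1 / a (Suc t))" for t
    proof -
      have "y t - x (Suc t) = (1 / a (Suc t)) *\<^sub>R (z t - z (Suc t))"
        by (simp add: x_eq y_eq scaleR_diff_right)
      moreover have "norm (z t - z (Suc t)) \<le> 2 * M"
        using norm_triangle_ineq4[of "z t" "z (Suc t)"] M[of t] M[of "Suc t"] by linarith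
      ultimately show ?thesis
        using a_ge_1[of "Suc t"] by (simp add: divide_right_mono)
    qed
    show "(\<lambda>t. 2 * M * (1 / a (Suc t))) \<longlonglongrightarrow> 0"
      by (intro tendsto_mult_right_zero LIMSEQ_Suc[OF inverse_a_tendsto])
  qed
  then have y: "(\<lambda>t. y t \<bullet> p) \<longlonglongrightarrow> l \<bullet> p" for p
    using tendsto_add[OF tendsto_inner[OF _ tendsto_const, of "\<lambda>t. y t - x (Suc t)" 0 _ p] LIMSEQ_Suc[OF l(3)[of p]]]
    by (simp add: inner_diff_left)
  have weak: "weakly_converges s l" if s: "\<And>p. (\<lambda>t. s t \<bullet> p) \<longlonglongrightarrow> l \<bullet> p" for s
    unfolding weakly_converges_def
  proof (intro allI impI)
    fix \<phi> :: "'x \<Rightarrow> real" assume "bounded_linear \<phi>"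
    then obtain r where r: "\<And>p. \<phi> p = p \<bullet> r" using riesz_representation by blast
    show "(\<lambda>n. \<phi> (s n)) \<longlonglongrightarrow> \<phi> l" unfolding r by (rule s)
  qed
  show ?thesis
    using is_arg_minI[OF l(1,2)] weak[OF l(3)] weak[OF y] by blast
qed

end

theorem theorem3p16:
  fixes f :: "'x::{real_inner,complete_space} \<Rightarrow> real"
    and gradf :: "'x \<Rightarrow> 'x"
    and K :: "'x \<Rightarrow> 'u::{real_inner,complete_space}"
    and b :: 'u
    and Lf \<gamma> \<tau> \<nu> :: real
    and a :: "nat \<Rightarrow> real"
    and x y zh z :: "nat \<Rightarrow> 'x"
    and u v :: "nat \<Rightarrow> 'u"
  assumes convex: "convex_on UNIV f"
    and gradient: "\<And>p. GDERIV f p :> gradf p"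
    and Lf_pos: "Lf > 0"
    and smooth: "Lf-lipschitz_on UNIV gradf"
    and K_bounded_linear: "bounded_linear K"
    and K_nonzero: "K \<noteq> (\<lambda>_. 0)"
    and b_range: "b \<in> range K"
    and solution_exists: "\<exists>xs. is_arg_min f (\<lambda>p. K p = b) xs"
    and lambda_pos: "lambda_min_pos K > 0"
    and algorithm: "apapc gradf K b \<gamma> \<tau> a x y zh z u v"
    and v0_range: "v 0 \<in> range K"
    and gamma_le: "\<gamma> \<le> 1 / (2 * Lf)"
    and nu: "0 < \<nu>" "\<nu> \<le> 1"
    and tau: "\<tau> = \<nu> / (\<gamma> * (onorm K)\<^sup>2)"
    and a_init: "a 0 = 1" "a 1 = 1"
    and a_rec: "\<And>t. t \<ge> 1 \<Longrightarrow> a (Suc t) =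
      min (min (a t * sqrt (1 + \<nu> * lambda_min_pos K / (4 * (onorm K)\<^sup>2)))
               (sqrt ((a t)\<^sup>2 + a t * (\<nu> * lambda_min_pos K / (4 * \<gamma> * Lf * (onorm K)\<^sup>2)))))
          ((1 + sqrt (1 + 4 * (a t)\<^sup>2)) / 2)"
  shows "(\<forall>xs us. 0 = gradf xs + adjoint K us \<and> us \<in> range K \<and> K xs = b \<longrightarrow>
            decseq (energy f K b Lf \<gamma> \<tau> a x z u v xs us) \<and>
            (\<lambda>t. lagrangian_gap f K b xs us (x t) (u t)) \<in> O(\<lambda>t. 1 / (real t)\<^sup>2) \<and>
            (\<lambda>t. (norm (v t - us))\<^sup>2) \<in> O(\<lambda>t. 1 / real t))
       \<and> bounded (range z)
       \<and> a \<in> \<Theta>(\<lambda>t. real t)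
       \<and> (\<lambda>t. norm (K (z t) - b)) \<longlonglongrightarrow> 0
       \<and> (\<exists>xs. is_arg_min f (\<lambda>p. K p = b) xs \<and> weakly_converges x xs \<and> weakly_converges y xs)"
proof -
  interpret run: apapc_run f gradf K b Lf \<gamma> \<tau> \<nu> a x y zh z u v
    by (rule apapc_run.intro; fact)
  \<comment> \<open>The first conjunct ranges over all saddle points, so the energy facts are
    applied at an arbitrary one.\<close>
  have saddle: "apapc_saddle f gradf K b Lf \<gamma> \<tau> \<nu> a x y zh z u v xs us"
    if "0 = gradf xs + adjoint K us" "us \<in> range K" "K xs = b" for xs us
    using that by unfold_locales
  obtain xs where xs: "is_arg_min f (\<lambda>p. K p = b) xs" using solution_exists by blast
  \<comment> \<open>Boundedness, feasibility and weak convergence are proved relative to a saddle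
    point; the assumed solution supplies one.\<close>
  obtain us where us: "us \<in> range K" "0 = gradf xs + adjoint K us"
    using lagrange_multiplier_exists[OF gradient smooth K_bounded_linear lambda_pos xs] by blast
  interpret s: apapc_saddle f gradf K b Lf \<gamma> \<tau> \<nu> a x y zh z u v xs us
    using us xs by (intro saddle) (auto simp: is_arg_min_def)
  show ?thesis
    using apapc_saddle.energy_decseq[OF saddle] apapc_saddle.gap_rate[OF saddle]
      apapc_saddle.dual_rate[OF saddle] s.z_bounded run.a_bigtheta s.z_feasibility s.weak_convergence
    by blast
qed

end
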